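(* Let $n\ge 3$ and let $v\in\mathbb{C}^n$ be a non-zero isotropic element, i.e. $(v,v)=\sum_{j=1}^n v_j^2=0$. Then the complex $n$-dimensional vector space $$\mathcal{E}_v=\{\phi_a:\mathrm{SO}(n,\mathbb{C})\to\mathbb{C}\mid \phi_a(z)=\operatorname{trace}(v^t a z^t),\ a\in\mathbb{C}^n\}$$ is an eigenfamily on the semi-Riemannian Lie group $\mathrm{SO}(n,\mathbb{C})$ such that for all $\phi,\psi\in\mathcal{E}_v$ we have $$\tau(\phi)=-(n-1)\cdot\phi,\qquad\kappa(\phi,\psi)=-\phi\cdot\psi.$$
   Context: Elements of $\mathbb{C}^n$ are row vectors, so $v^ta$ is the $n\times n$ matrix $(v_ja_\alpha)_{j\alpha}$. The real Lie group $\mathrm{SO}(n,\mathbb{C})=\{z\in\mathrm{SL}_n(\mathbb{C})\mid z z^t=I_n\}$ carries the left-invariant semi-Riemannian metric $g$ determined by $g(Z,W)=-\operatorname{Re}\operatorname{trace}(ZW)$ on its Lie algebra $\mathfrak{so}(n,\mathbb{C})=\{Z\in\mathbb{C}^{n\times n}\mid Z+Z^t=0\}$. For smooth complex-valued functions $\phi,\psi$, $\tau(\phi)=\operatorname{div}(\nabla\phi)$ is the Laplace-Beltrami operator (tension field) and $\kappa(\phi,\psi)=g(\nabla\phi,\nabla\psi)$ is the conformality operator, where $g$ is extended complex-bilinearly to the complexified tangent bundle. A set $\mathcal{E}$ of complex-valued functions is an eigenfamily if there exist $\lambda,\mu\in\mathbb{C}$ with $\tau(\phi)=\lambda\phi$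 and $\kappa(\phi,\psi)=\mu\phi\psi$ for all $\phi,\psi\in\mathcal{E}$. *)

theory Defs
  imports "HOL-Analysis.Analysis" "HOL-Library.Function_Algebras"
begin

section \<open>Calculus on embedded submanifolds of Euclidean space\<close>

text \<open>
  A manifold is given as an embedded submanifold \<open>M\<close> of a Euclidean space \<open>'a\<close>.  Functions and
  vector fields on \<open>M\<close> are total functions on \<open>'a\<close> of which only the values on \<open>M\<close> matter.
\<close>

primrec C_k_on :: "nat \<Rightarrow> 'a::euclidean_space set \<Rightarrow> ('a \<Rightarrow> 'b::real_normed_vector) \<Rightarrow> bool" where
  "C_k_on 0 U f \<longleftrightarrow> continuous_on U f"
| "C_k_on (Suc k) U f \<longleftrightarrow>
     (\<forall>x\<in>U. f differentiable (at x)) \<and> (\<forall>w. C_k_on k U (\<lambda>x. frechet_derivative f (at x) w))"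

text \<open>Infinite differentiability on an \<^emph>\<open>open\<close> set \<open>U\<close> of the ambient space.\<close>

definition smooth_on_open :: "'a::euclidean_space set \<Rightarrow> ('a \<Rightarrow> 'b::real_normed_vector) \<Rightarrow> bool" where
  "smooth_on_open U f \<longleftrightarrow> (\<forall>k. C_k_on k U f)"

definition smooth :: "'a::euclidean_space set \<Rightarrow> ('a \<Rightarrow> 'b::real_normed_vector) \<Rightarrow> bool" where
  "smooth M f \<longleftrightarrow>
     (\<forall>p\<in>M. \<exists>U F. open U \<and> p \<in> U \<and> smooth_on_open U F \<and> (\<forall>x\<in>M \<inter> U. F x = f x))"

definition tangent_space :: "'a::euclidean_space set \<Rightarrow> 'a \<Rightarrow> 'a set" where
  "tangent_space M p =
     {X. \<exists>\<gamma> e. e > 0 \<and> smooth_on_open {-e<..<e::real} \<gamma> \<and> \<gamma> ` {-e<..<e} \<subseteq> M \<and> \<gamma> 0 = p \<and>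
           (\<gamma> has_vector_derivative X) (at 0)}"

text \<open>
  The derivative within \<open>M\<close> depends only on the values of \<open>f\<close> on \<open>M\<close>.  As a linear map on the
  ambient space it need not be unique, but by the chain rule along curves in \<open>M\<close> its values on
  \<open>tangent_space M p\<close> are, and it is only applied to such vectors.
\<close>

definition differential ::
    "'a::euclidean_space set \<Rightarrow> ('a \<Rightarrow> 'b::real_normed_vector) \<Rightarrow> 'a \<Rightarrow> 'a \<Rightarrow> 'b" where
  "differential M f p X = frechet_derivative f (at p within M) X"

definition vector_field :: "'a::euclidean_space set \<Rightarrow> ('a \<Rightarrow> 'a) \<Rightarrow> bool" where
  "vector_field M X \<longleftrightarrow> smooth M X \<and> (\<forall>p\<in>M. X p \<in> tangent_space M p)"

text \<open>Vector fields are differentiated here as functions with values in the ambient space.\<close>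

definition lie_bracket ::
    "'a::euclidean_space set \<Rightarrow> ('a \<Rightarrow> 'a) \<Rightarrow> ('a \<Rightarrow> 'a) \<Rightarrow> 'a \<Rightarrow> 'a" where
  "lie_bracket M X Y p = differential M Y p (X p) - differential M X p (Y p)"

section \<open>Semi-Riemannian operators\<close>

text \<open>
  A metric \<open>g\<close> assigns to each \<open>p \<in> M\<close> a bilinear form \<open>g p\<close>, used only on \<open>tangent_space M p\<close>.
  It need not be related to the inner product of the ambient space.
\<close>

type_synonym 'a metric = "'a \<Rightarrow> 'a \<Rightarrow> 'a \<Rightarrow> real"

definition levi_civita ::
    "'a::euclidean_space set \<Rightarrow> 'a metric \<Rightarrow> (('a \<Rightarrow> 'a) \<Rightarrow> ('a \<Rightarrow> 'a) \<Rightarrow> ('a \<Rightarrow> 'a)) \<Rightarrow> bool" where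
  "levi_civita M g D \<longleftrightarrow>
     (\<forall>X Y. vector_field M X \<and> vector_field M Y \<longrightarrow> vector_field M (D X Y)) \<and>
     (\<forall>X X' Y. vector_field M X \<and> vector_field M X' \<and> vector_field M Y \<longrightarrow>
        (\<forall>p\<in>M. D (\<lambda>q. X q + X' q) Y p = D X Y p + D X' Y p)) \<and>
     (\<forall>(f :: 'a \<Rightarrow> real) X Y. smooth M f \<and> vector_field M X \<and> vector_field M Y \<longrightarrow>
        (\<forall>p\<in>M. D (\<lambda>q. f q *\<^sub>R X q) Y p = f p *\<^sub>R D X Y p)) \<and>
     (\<forall>X Y Y'. vector_field M X \<and> vector_field M Y \<and> vector_field M Y' \<longrightarrow>
        (\<forall>p\<in>M. D X (\<lambda>q. Y q + Y' q) p = D X Y p + D X Y' p)) \<and>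
     (\<forall>(f :: 'a \<Rightarrow> real) X Y. smooth M f \<and> vector_field M X \<and> vector_field M Y \<longrightarrow>
        (\<forall>p\<in>M. D X (\<lambda>q. f q *\<^sub>R Y q) p = differential M f p (X p) *\<^sub>R Y p + f p *\<^sub>R D X Y p)) \<and>
     (\<forall>X Y. vector_field M X \<and> vector_field M Y \<longrightarrow>
        (\<forall>p\<in>M. D X Y p - D Y X p = lie_bracket M X Y p)) \<and>
     (\<forall>X Y Z. vector_field M X \<and> vector_field M Y \<and> vector_field M Z \<longrightarrow>
        (\<forall>p\<in>M. differential M (\<lambda>q. g q (Y q) (Z q)) p (X p) =
                g p (D X Y p) (Z p) + g p (Y p) (D X Z p)))"

definition levi_civita_connection ::
    "'a::euclidean_space set \<Rightarrow> 'a metric \<Rightarrow> ('a \<Rightarrow> 'a) \<Rightarrow> ('a \<Rightarrow> 'a) \<Rightarrow> ('a \<Rightarrow> 'a)" where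
  "levi_civita_connection M g = (SOME D. levi_civita M g D)"

text \<open>Covariant derivative along a single tangent vector \<open>w\<close> at \<open>p\<close>, well defined by tensoriality.\<close>

definition covariant_derivative ::
    "'a::euclidean_space set \<Rightarrow> 'a metric \<Rightarrow> ('a \<Rightarrow> 'a) \<Rightarrow> 'a \<Rightarrow> 'a \<Rightarrow> 'a" where
  "covariant_derivative M g X p w =
     levi_civita_connection M g (SOME V. vector_field M V \<and> V p = w) X p"

text \<open>Trace of an endomorphism \<open>L\<close> of a linear subspace \<open>T\<close>, read off from any basis of \<open>T\<close>.\<close>

definition trace_on :: "'a::euclidean_space set \<Rightarrow> ('a \<Rightarrow> 'a) \<Rightarrow> real" where
  "trace_on T L =
     (let B = (SOME B. independent B \<and> span B = T) in \<Sum>b\<in>B. representation B (L b) b)"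

definition divergence :: "'a::euclidean_space set \<Rightarrow> 'a metric \<Rightarrow> ('a \<Rightarrow> 'a) \<Rightarrow> 'a \<Rightarrow> real" where
  "divergence M g X p = trace_on (tangent_space M p) (covariant_derivative M g X p)"

definition gradient :: "'a::euclidean_space set \<Rightarrow> 'a metric \<Rightarrow> ('a \<Rightarrow> real) \<Rightarrow> 'a \<Rightarrow> 'a" where
  "gradient M g f p =
     (THE X. X \<in> tangent_space M p \<and> (\<forall>Y\<in>tangent_space M p. g p X Y = differential M f p Y))"

text \<open>
  The pair \<open>(X, Y)\<close> stands for the vector \<open>X + \<i> Y\<close> of the complexified tangent space.  Even if the
  ambient space has its own complex structure, this \<open>\<i>\<close> is unrelated to it.  The metric, the
  gradient and the divergence are extended complex-(bi)linearly.
\<close>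

definition metric_C :: "'a metric \<Rightarrow> 'a \<Rightarrow> 'a \<times> 'a \<Rightarrow> 'a \<times> 'a \<Rightarrow> complex" where
  "metric_C g p Z W =
     Complex (g p (fst Z) (fst W) - g p (snd Z) (snd W)) (g p (fst Z) (snd W) + g p (snd Z) (fst W))"

definition gradient_C ::
    "'a::euclidean_space set \<Rightarrow> 'a metric \<Rightarrow> ('a \<Rightarrow> complex) \<Rightarrow> 'a \<Rightarrow> 'a \<times> 'a" where
  "gradient_C M g \<phi> p = (gradient M g (\<lambda>q. Re (\<phi> q)) p, gradient M g (\<lambda>q. Im (\<phi> q)) p)"

definition divergence_C ::
    "'a::euclidean_space set \<Rightarrow> 'a metric \<Rightarrow> ('a \<Rightarrow> 'a \<times> 'a) \<Rightarrow> 'a \<Rightarrow> complex" where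
  "divergence_C M g Z p =
     Complex (divergence M g (\<lambda>q. fst (Z q)) p) (divergence M g (\<lambda>q. snd (Z q)) p)"

definition tension ::
    "'a::euclidean_space set \<Rightarrow> 'a metric \<Rightarrow> ('a \<Rightarrow> complex) \<Rightarrow> 'a \<Rightarrow> complex" where
  "tension M g \<phi> = divergence_C M g (gradient_C M g \<phi>)"

definition conformality ::
    "'a::euclidean_space set \<Rightarrow> 'a metric \<Rightarrow> ('a \<Rightarrow> complex) \<Rightarrow> ('a \<Rightarrow> complex) \<Rightarrow> 'a \<Rightarrow> complex" where
  "conformality M g \<phi> \<psi> p = metric_C g p (gradient_C M g \<phi> p) (gradient_C M g \<psi> p)"

definition eigenfamily ::
    "'a::euclidean_space set \<Rightarrow> 'a metric \<Rightarrow> ('a \<Rightarrow> complex) set \<Rightarrow> bool" where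
  "eigenfamily M g E \<longleftrightarrow>
     (\<forall>\<phi>\<in>E. smooth M \<phi>) \<and>
     (\<exists>lam mu. \<forall>\<phi>\<in>E. \<forall>\<psi>\<in>E. \<forall>p\<in>M.
        tension M g \<phi> p = lam * \<phi> p \<and> conformality M g \<phi> \<psi> p = mu * \<phi> p * \<psi> p)"

section \<open>The complex special orthogonal group\<close>

definition SO_C :: "(complex ^ 'n ^ 'n) set" where
  "SO_C = {z. det z = 1 \<and> z ** transpose z = mat 1}"

text \<open>
  Left-invariant extension of the form \<open>(Z, W) \<mapsto> - Re (trace (Z W))\<close> on the Lie algebra, the
  tangent space of \<open>SO_C\<close> at \<open>mat 1\<close>, which consists of the \<open>Z\<close> with \<open>Z + transpose Z = 0\<close>:
  tangent vectors at \<open>z\<close> are translated back by the inverse of \<open>z\<close>.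
\<close>

definition SO_metric :: "(complex ^ 'n ^ 'n) metric" where
  "SO_metric z X Y = - Re (trace ((matrix_inv z ** X) ** (matrix_inv z ** Y)))"

definition outer :: "complex ^ 'n \<Rightarrow> complex ^ 'n \<Rightarrow> complex ^ 'n ^ 'n" where
  "outer v a = (\<chi> j k. v $ j * a $ k)"

text \<open>
  Functions \<open>SO_C \<rightarrow> \<complex>\<close> are represented by their extension by zero, so that equality of functions
  on \<open>SO_C\<close> is equality in HOL and the dimension below is that of a space of functions on \<open>SO_C\<close>.
\<close>

definition \<phi>_fun :: "complex ^ 'n \<Rightarrow> complex ^ 'n \<Rightarrow> complex ^ 'n ^ 'n \<Rightarrow> complex" where
  "\<phi>_fun v a z = (if z \<in> SO_C then trace (outer v a ** transpose z) else 0)"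

definition E_fam :: "complex ^ 'n \<Rightarrow> (complex ^ 'n ^ 'n \<Rightarrow> complex) set" where
  "E_fam v = range (\<phi>_fun v)"

interpretation cfun: vector_space "\<lambda>(c::complex) (f :: 'x \<Rightarrow> complex) x. c * f x"
  by unfold_locales (auto simp: fun_eq_iff algebra_simps)

end

(*
  On tangent vectors the metric of SO(n,C) coincides with the constant bilinear form
  Re (trace (Y^t Z)) on all complex matrices.  Hence the Levi-Civita connection is the tangential
  part of the flat one, D_X Y = dY(X) + 1/2 p (X^t Y + Y^t X) at p, and the gradient of
  q |-> Re (trace (A^t q)) is the tangential part 1/2 (A - p A^t p) of A.  The covariant derivative of
  this gradient is w |-> -1/4 (w R + S w) with R = A^t p + p^t A and S = p A^t + A p^t; its trace over the
  tangent space is -(n-1) Re (trace (A^t p)).  For A = v^t a and B = v^t b the conformality operator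
  reduces to trace (A^t B) - trace (A^t p B^t p), where the first term vanishes because v is isotropic
  and the second is the product of the two functions because A and B have rank one.
*)

theory Submission
  imports Defs
begin

section \<open>Iterated differentiability\<close>

text \<open>The operators are built from choices: a connection, an extension of a tangent vector, a
  basis of the tangent space, a derivative that is not unique off the tangent space. Nothing can be
  computed before each choice is shown to be harmless. This is why uniqueness of the Levi-Civita
  connection is proved, and why the trace over an unknown basis becomes a trace over the ambient
  space, by composing with a projection. The factor n-1 then splits: n comes from the summand b in
  the projection of a basis matrix b, and -1 from its transposed summand. The imaginary unit of the
  complexified tangent space is unrelated to that of the matrix entries, so the geometry is done
  with real functions; Re \<phi>_a suffices, because Im \<phi>_a is Re \<phi>_b with b = -i a. The
  dimension claim needs injectivity of a |-> \<phi>_a on the group alone. Values yield the products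
  v_j a_j, while the products v_j a_k with j \<noteq> k are reached through derivatives; n \<ge> 3
  supplies the third index that separates v_j a_k from v_k a_j.\<close>

lemma C_k_on_cong:
  assumes "open U" "C_k_on k U f" "\<And>x. x \<in> U \<Longrightarrow> f x = g x"
  shows "C_k_on k U g"
  using assms(2,3)
proof (induction k arbitrary: f g)
  case 0
  then show ?case by (simp cong: continuous_on_cong)
next
  case (Suc k)
  have der: "(g has_derivative frechet_derivative f (at x)) (at x)" if "x \<in> U" for x
  proof (rule has_derivative_transform_within_open[OF _ assms(1) that])
    show "(f has_derivative frechet_derivative f (at x)) (at x)"
      using Suc.prems(1) that by (simp add: frechet_derivative_works)
  qed (use Suc.prems in auto)
  have eq: "frechet_derivative f (at x) w = frechet_derivative g (at x) w" if "x \<in> U" for x w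
    using frechet_derivative_at[OF der[OF that]] by simp
  have "C_k_on k U (\<lambda>x. frechet_derivative g (at x) w)" for w
    by (rule Suc.IH[of "\<lambda>x. frechet_derivative f (at x) w"]) (use Suc.prems eq in auto)
  moreover have "g differentiable (at x)" if "x \<in> U" for x
    using der[OF that] by (auto simp: differentiable_def)
  ultimately show ?case by simp
qed

text \<open>\<open>C_k_on\<close> refers to the chosen \<open>frechet_derivative\<close>; on an open
  set any explicit derivative \<open>f'\<close> coincides with it. The inductions below that compute
  a derivative by hand enter through this rule.\<close>

lemma C_k_on_SucI:
  assumes "open U" and der: "\<And>x. x \<in> U \<Longrightarrow> (f has_derivative f' x) (at x)"
    and "\<And>w. C_k_on k U (\<lambda>x. f' x w)"
  shows "C_k_on (Suc k) U f"
proof -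
  have "f' x w = frechet_derivative f (at x) w" if "x \<in> U" for x w
    using frechet_derivative_at[OF der[OF that]] by simp
  then have "C_k_on k U (\<lambda>x. frechet_derivative f (at x) w)" for w
    using C_k_on_cong[OF assms(1) assms(3)] by simp
  then show ?thesis
    using der by (auto simp: differentiable_def)
qed

text \<open>Needed for product rules, whose summands keep one factor undifferentiated: that factor
  is given in order \<open>Suc k\<close> and used in order \<open>k\<close>.\<close>

lemma C_k_on_SucD: "C_k_on (Suc k) U f \<Longrightarrow> C_k_on k U f"
proof (induction k arbitrary: f)
  case 0
  then show ?case
    by (simp add: continuous_at_imp_continuous_on differentiable_imp_continuous_within)
next
  case (Suc k)
  have "C_k_on k U (\<lambda>x. frechet_derivative f (at x) w)" for w
    by (rule Suc.IH) (use Suc.prems in auto)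
  then show ?case using Suc.prems by simp
qed

lemma C_k_on_has_derivative:
  "C_k_on (Suc k) U f \<Longrightarrow> x \<in> U \<Longrightarrow> (f has_derivative frechet_derivative f (at x)) (at x)"
  by (simp add: frechet_derivative_works)

lemma C_k_on_subset: "C_k_on k U f \<Longrightarrow> V \<subseteq> U \<Longrightarrow> C_k_on k V f"
  by (induction k arbitrary: f) (auto intro: continuous_on_subset)

lemma C_k_on_const:
  assumes "open U"
  shows "C_k_on k U (\<lambda>x. c)"
proof (induction k arbitrary: c)
  case (Suc k)
  show ?case by (rule C_k_on_SucI[OF assms has_derivative_const Suc.IH])
qed auto

lemma C_k_on_linear:
  assumes "open U" "bounded_linear L"
  shows "C_k_on k U L"
proof (cases k)
  case 0
  then show ?thesis using assms(2) by (simp add: linear_continuous_on)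
next
  case (Suc k')
  show ?thesis
    unfolding Suc
    by (rule C_k_on_SucI[OF assms(1) bounded_linear_imp_has_derivative[OF assms(2)] C_k_on_const[OF assms(1)]])
qed

lemma C_k_on_add:
  assumes "open U" "C_k_on k U f" "C_k_on k U g"
  shows "C_k_on k U (\<lambda>x. f x + g x)"
  using assms(2,3)
proof (induction k arbitrary: f g)
  case 0
  then show ?case by (auto intro: continuous_on_add)
next
  case (Suc k)
  have der: "((\<lambda>x. f x + g x) has_derivative
      (\<lambda>w. frechet_derivative f (at x) w + frechet_derivative g (at x) w)) (at x)" if "x \<in> U" for x
    using has_derivative_add[OF C_k_on_has_derivative C_k_on_has_derivative] Suc.prems that by blast
  show ?case by (rule C_k_on_SucI[OF assms(1) der]) (use Suc in auto)
qed

lemma C_k_on_bilinear: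
  assumes "open U" "bounded_bilinear h" "C_k_on k U f" "C_k_on k U g"
  shows "C_k_on k U (\<lambda>x. h (f x) (g x))"
  using assms(3,4)
proof (induction k arbitrary: f g)
  case 0
  then show ?case using bounded_bilinear.continuous_on[OF assms(2)] by simp
next
  case (Suc k)
  interpret bounded_bilinear h by fact
  have der: "((\<lambda>x. h (f x) (g x)) has_derivative
      (\<lambda>w. h (f x) (frechet_derivative g (at x) w) + h (frechet_derivative f (at x) w) (g x))) (at x)"
    if "x \<in> U" for x
    using FDERIV[OF C_k_on_has_derivative C_k_on_has_derivative] Suc.prems that by blast
  have "C_k_on k U
      (\<lambda>x. h (f x) (frechet_derivative g (at x) w) + h (frechet_derivative f (at x) w) (g x))" for w
    using Suc.prems assms(1) C_k_on_SucD[OF Suc.prems(1)] C_k_on_SucD[OF Suc.prems(2)]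
    by (intro C_k_on_add Suc.IH) auto
  from C_k_on_SucI[OF assms(1) der this] show ?case .
qed

lemma C_k_on_bounded_linear:
  assumes "open U" "bounded_linear L" "C_k_on k U f"
  shows "C_k_on k U (\<lambda>x. L (f x))"
  using assms(3)
proof (induction k arbitrary: f)
  case 0
  then show ?case using bounded_linear.continuous_on[OF assms(2)] by simp
next
  case (Suc k)
  have der: "((\<lambda>x. L (f x)) has_derivative (\<lambda>w. L (frechet_derivative f (at x) w))) (at x)"
    if "x \<in> U" for x
    using bounded_linear.has_derivative[OF assms(2) C_k_on_has_derivative] Suc.prems that by blast
  show ?case by (rule C_k_on_SucI[OF assms(1) der]) (use Suc in auto)
qed

lemma C_k_on_sum:
  assumes "open U" "\<And>i. i \<in> I \<Longrightarrow> C_k_on k U (f i)"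
  shows "C_k_on k U (\<lambda>x. \<Sum>i\<in>I. f i x)"
  using assms(2)
  by (induction I rule: infinite_finite_induct) (simp_all add: C_k_on_const C_k_on_add assms(1))

section \<open>Smooth functions, tangent vectors and differentials on embedded submanifolds\<close>

lemma smooth_cong:
  assumes "smooth M f" "\<And>x. x \<in> M \<Longrightarrow> f x = g x"
  shows "smooth M g"
  using assms unfolding smooth_def by (metis IntE)

lemma smooth_local2:
  assumes "smooth M f" "smooth M g" "p \<in> M"
  obtains U F G where "open U" "p \<in> U" "smooth_on_open U F" "smooth_on_open U G"
    "\<And>x. x \<in> M \<inter> U \<Longrightarrow> F x = f x" "\<And>x. x \<in> M \<inter> U \<Longrightarrow> G x = g x"
proof -
  obtain U F where U: "open U" "p \<in> U" "smooth_on_open U F" "\<forall>x\<in>M \<inter> U. F x = f x"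
    using assms(1,3) unfolding smooth_def by blast
  obtain V G where V: "open V" "p \<in> V" "smooth_on_open V G" "\<forall>x\<in>M \<inter> V. G x = g x"
    using assms(2,3) unfolding smooth_def by blast
  show ?thesis
  proof (rule that[of "U \<inter> V" F G])
    show "smooth_on_open (U \<inter> V) F" "smooth_on_open (U \<inter> V) G"
      using U V C_k_on_subset unfolding smooth_on_open_def by blast+
  qed (use U V in auto)
qed

lemma smooth_linear:
  assumes "bounded_linear L"
  shows "smooth M L"
  unfolding smooth_def smooth_on_open_def
  using C_k_on_linear[OF open_UNIV assms] by blast

lemma smooth_const: "smooth M (\<lambda>x. c)"
  unfolding smooth_def smooth_on_open_def
  using C_k_on_const[OF open_UNIV] by blast

lemma smooth_bilinear:
  assumes "bounded_bilinear h" "smooth M f" "smooth M g"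
  shows "smooth M (\<lambda>x. h (f x) (g x))"
  unfolding smooth_def
proof
  fix p assume "p \<in> M"
  then obtain U F G where "open U" "p \<in> U" "smooth_on_open U F" "smooth_on_open U G"
    "\<And>x. x \<in> M \<inter> U \<Longrightarrow> F x = f x" "\<And>x. x \<in> M \<inter> U \<Longrightarrow> G x = g x"
    using smooth_local2[OF assms(2,3)] by blast
  then show "\<exists>U H. open U \<and> p \<in> U \<and> smooth_on_open U H \<and> (\<forall>x\<in>M \<inter> U. H x = h (f x) (g x))"
    using C_k_on_bilinear[OF _ assms(1), of U _ F G] unfolding smooth_on_open_def
    by (intro exI[of _ U] exI[of _ "\<lambda>x. h (F x) (G x)"]) auto
qed

lemma smooth_add:
  assumes "smooth M f" "smooth M g"
  shows "smooth M (\<lambda>x. f x + g x)"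
  unfolding smooth_def
proof
  fix p assume "p \<in> M"
  then obtain U F G where "open U" "p \<in> U" "smooth_on_open U F" "smooth_on_open U G"
    "\<And>x. x \<in> M \<inter> U \<Longrightarrow> F x = f x" "\<And>x. x \<in> M \<inter> U \<Longrightarrow> G x = g x"
    using smooth_local2[OF assms] by blast
  then show "\<exists>U H. open U \<and> p \<in> U \<and> smooth_on_open U H \<and> (\<forall>x\<in>M \<inter> U. H x = f x + g x)"
    using C_k_on_add[of U _ F G] unfolding smooth_on_open_def
    by (intro exI[of _ U] exI[of _ "\<lambda>x. F x + G x"]) auto
qed

lemma smooth_bounded_linear:
  assumes "bounded_linear L" "smooth M f"
  shows "smooth M (\<lambda>x. L (f x))"
  using assms C_k_on_bounded_linear[OF _ assms(1)] unfolding smooth_def smooth_on_open_def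
  by (metis (no_types, lifting))

section \<open>Derivatives within an embedded submanifold\<close>

lemma smooth_has_derivative_within:
  assumes "open U" "p \<in> M \<inter> U" "smooth_on_open U F" "\<And>x. x \<in> M \<inter> U \<Longrightarrow> F x = f x"
  shows "(f has_derivative frechet_derivative F (at p)) (at p within M)"
proof -
  have "(F has_derivative frechet_derivative F (at p)) (at p)"
    using assms C_k_on_has_derivative[of 0 U F] unfolding smooth_on_open_def by blast
  then have *: "(F has_derivative frechet_derivative F (at p)) (at p within M)"
    by (rule has_derivative_at_withinI)
  obtain d where d: "d > 0" "ball p d \<subseteq> U"
    using assms(1,2) open_contains_ball by blast
  show ?thesis
    by (rule has_derivative_transform_within[OF * d(1)])
       (use assms d in \<open>auto simp: subset_iff dist_commute\<close>)
qed

lemma smooth_imp_has_derivative: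
  assumes "smooth M f" "p \<in> M"
  shows "(f has_derivative frechet_derivative f (at p within M)) (at p within M)"
  using assms smooth_has_derivative_within[of _ p M _ f] frechet_derivative_works
  unfolding smooth_def differentiable_def by (metis IntI)

text \<open>Composed with a curve in \<open>M\<close> of velocity \<open>X\<close>, either candidate
  gives the derivative at 0 of the same function of one real variable, where derivatives are
  unique.\<close>

lemma has_derivative_unique_tangent:
  assumes "(f has_derivative f1) (at p within M)" "(f has_derivative f2) (at p within M)"
    and "X \<in> tangent_space M p"
  shows "f1 X = f2 X"
proof -
  obtain \<gamma> e where e: "e > 0" "\<gamma> ` {-e<..<e} \<subseteq> M" "\<gamma> 0 = p"
    and \<gamma>: "(\<gamma> has_vector_derivative X) (at 0)"
    using assms(3) unfolding tangent_space_def by blast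
  have at: "at 0 within {-e<..<e} = at (0::real)"
    using e(1) by (intro at_within_open) auto
  have "(f \<circ> \<gamma> has_vector_derivative f' X) (at 0)" if "(f has_derivative f') (at p within M)" for f'
    using vector_derivative_diff_chain_within[of \<gamma> X 0 "{-e<..<e}" f f'] \<gamma> that e at
    by (auto intro: has_derivative_subset)
  then show ?thesis
    using assms(1,2) vector_derivative_unique_at by blast
qed

lemma differential_eq:
  assumes "(f has_derivative f') (at p within M)" "X \<in> tangent_space M p"
  shows "differential M f p X = f' X"
  using assms has_derivative_unique_tangent frechet_derivative_works
  unfolding differential_def differentiable_def by metis

lemma differential_cong:
  assumes "smooth M f" "p \<in> M" "X \<in> tangent_space M p" "\<And>x. x \<in> M \<Longrightarrow> g x = f x"
  shows "differential M g p X = differential M f p X"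
proof -
  have "(g has_derivative frechet_derivative f (at p within M)) (at p within M)"
    using assms smooth_imp_has_derivative by (metis has_derivative_transform)
  then show ?thesis
    using differential_eq assms(3) unfolding differential_def by metis
qed

lemma linear_differential: "smooth M f \<Longrightarrow> p \<in> M \<Longrightarrow> linear (differential M f p)"
  using smooth_imp_has_derivative has_derivative_linear unfolding differential_def by blast

lemma differential_bilinear:
  assumes "bounded_bilinear h" "smooth M f" "smooth M g" "p \<in> M" "X \<in> tangent_space M p"
  shows "differential M (\<lambda>x. h (f x) (g x)) p X =
    h (f p) (differential M g p X) + h (differential M f p X) (g p)"
  using differential_eq[OF bounded_bilinear.FDERIV[OF assms(1)
      smooth_imp_has_derivative[OF assms(2,4)] smooth_imp_has_derivative[OF assms(3,4)]] assms(5)]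
  unfolding differential_def .

lemma differential_add:
  assumes "smooth M f" "smooth M g" "p \<in> M" "X \<in> tangent_space M p"
  shows "differential M (\<lambda>x. f x + g x) p X = differential M f p X + differential M g p X"
  using differential_eq[OF has_derivative_add[OF smooth_imp_has_derivative[OF assms(1,3)]
      smooth_imp_has_derivative[OF assms(2,3)]] assms(4)]
  unfolding differential_def .

text \<open>The derivative within \<open>M\<close> is arbitrary off the tangent spaces and hence
  unsuitable for further differentiation. Instead a local extension \<open>F\<close> is
  differentiated and its derivative applied to a local extension of \<open>X\<close>. Since
  \<open>C_k_on\<close> controls derivatives along fixed vectors only, that value is expanded over
  \<open>Basis\<close>.\<close>

lemma smooth_differential:
  assumes "smooth M f" "vector_field M X"
  shows "smooth M (\<lambda>p. differential M f p (X p))"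
  unfolding smooth_def
proof
  fix p assume "p \<in> M"
  then obtain U F G where U: "open U" "p \<in> U" "smooth_on_open U F" "smooth_on_open U G"
    "\<And>x. x \<in> M \<inter> U \<Longrightarrow> F x = f x" "\<And>x. x \<in> M \<inter> U \<Longrightarrow> G x = X x"
    using smooth_local2[of M f X p] assms unfolding vector_field_def by metis
  define H where "H q = (\<Sum>b\<in>Basis. (G q \<bullet> b) *\<^sub>R frechet_derivative F (at q) b)" for q
  have "C_k_on k U (\<lambda>q. G q \<bullet> b)" for k b
    using C_k_on_bounded_linear[OF U(1) bounded_linear_inner_left, of k G b] U(4)
    unfolding smooth_on_open_def by blast
  moreover have "C_k_on k U (\<lambda>q. frechet_derivative F (at q) b)" for k b
    using U(3)[unfolded smooth_on_open_def, rule_format, of "Suc k"] by simp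
  ultimately have "smooth_on_open U H"
    unfolding H_def[abs_def] smooth_on_open_def
    by (intro allI C_k_on_sum C_k_on_bilinear[OF U(1) bounded_bilinear_scaleR] U(1))
  moreover have "H q = differential M f q (X q)" if q: "q \<in> M \<inter> U" for q
  proof -
    have lin: "linear (frechet_derivative F (at q))"
      using U(3) q C_k_on_has_derivative[of 0 U F q] has_derivative_linear
      unfolding smooth_on_open_def by blast
    have "H q = frechet_derivative F (at q) (\<Sum>b\<in>Basis. (G q \<bullet> b) *\<^sub>R b)"
      unfolding H_def by (simp add: linear_sum[OF lin] linear_cmul[OF lin])
    also have "\<dots> = frechet_derivative F (at q) (X q)"
      using U(6)[OF q] by (simp add: euclidean_representation)
    also have "\<dots> = differential M f q (X q)"
    proof (rule differential_eq[symmetric])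
      show "(f has_derivative frechet_derivative F (at q)) (at q within M)"
        using smooth_has_derivative_within[OF U(1) q U(3)] U(5) by blast
      show "X q \<in> tangent_space M q"
        using q assms(2) unfolding vector_field_def by blast
    qed
    finally show ?thesis .
  qed
  ultimately show "\<exists>U H. open U \<and> p \<in> U \<and> smooth_on_open U H \<and>
      (\<forall>x\<in>M \<inter> U. H x = differential M f x (X x))"
    using U by blast
qed

section \<open>Complex matrices\<close>

lemma bounded_bilinear_matrix_mult:
  "bounded_bilinear ((**) :: complex^'m^'l \<Rightarrow> complex^'n^'m \<Rightarrow> complex^'n^'l)"
  unfolding bilinear_conv_bounded_bilinear[symmetric] bilinear_def
  by (auto intro!: linearI simp: matrix_add_ldistrib matrix_scalar_ac scalar_matrix_assoc
      vec_eq_iff matrix_matrix_mult_def algebra_simps sum.distrib scaleR_sum_right)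

interpretation matrix_mult: bounded_bilinear
  "(**) :: complex^'m^'l \<Rightarrow> complex^'n^'m \<Rightarrow> complex^'n^'l"
  by (rule bounded_bilinear_matrix_mult)

lemma bounded_linear_transpose: "bounded_linear (transpose :: complex^'n^'m \<Rightarrow> complex^'m^'n)"
  by (intro linear_conv_bounded_linear[THEN iffD1] linearI) (auto simp: vec_eq_iff transpose_def)

lemma bounded_linear_trace: "bounded_linear (trace :: complex^'n^'n \<Rightarrow> complex)"
  by (intro linear_conv_bounded_linear[THEN iffD1] linearI)
     (auto simp: trace_def sum.distrib scaleR_sum_right)

lemmas transpose_linear_simps =
  linear_add[OF bounded_linear.linear[OF bounded_linear_transpose]]
  linear_diff[OF bounded_linear.linear[OF bounded_linear_transpose]]
  linear_neg[OF bounded_linear.linear[OF bounded_linear_transpose]]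
  linear_cmul[OF bounded_linear.linear[OF bounded_linear_transpose]]

lemmas trace_linear_simps =
  linear_add[OF bounded_linear.linear[OF bounded_linear_trace]]
  linear_diff[OF bounded_linear.linear[OF bounded_linear_trace]]
  linear_neg[OF bounded_linear.linear[OF bounded_linear_trace]]
  linear_cmul[OF bounded_linear.linear[OF bounded_linear_trace]]

lemmas matrix_linear_simps =
  matrix_mult.add_left matrix_mult.add_right matrix_mult.diff_left matrix_mult.diff_right
  matrix_mult.minus_left matrix_mult.minus_right matrix_mult.scaleR_left matrix_mult.scaleR_right
  transpose_linear_simps trace_linear_simps

lemma continuous_on_det:
  fixes f :: "'a::topological_space \<Rightarrow> complex^'n^'n"
  assumes "continuous_on S f"
  shows "continuous_on S (\<lambda>x. det (f x))"
  unfolding det_def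
  by (intro continuous_intros continuous_on_component assms)

section \<open>Smoothness of matrix inversion\<close>

lemma matrix_inv_inverse:
  fixes A :: "complex^'n^'n"
  assumes "det A \<noteq> 0"
  shows "A ** matrix_inv A = mat 1" "matrix_inv A ** A = mat 1"
  using assms unfolding invertible_det_nz[symmetric] invertible_def matrix_inv_def
  by (metis (mono_tags, lifting) someI_ex)+

lemma matrix_inv_unique:
  fixes A B :: "complex^'n^'n"
  assumes "A ** B = mat 1"
  shows "matrix_inv A = B"
proof -
  have "det A * det B = 1"
    using assms det_mul[of A B] det_I by metis
  then have "det A \<noteq> 0" by auto
  then show ?thesis
    by (metis assms matrix_inv_inverse(2) matrix_mul_assoc matrix_mul_lid matrix_mul_rid)
qed

text \<open>Cramer's rule makes each entry of the inverse a quotient of polynomials in the entries;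
  this is the source of its continuity.\<close>

lemma matrix_inv_cramer:
  fixes A :: "complex^'n^'n"
  assumes "det A \<noteq> 0"
  shows "matrix_inv A $ i $ j = det (\<chi> k l. if l = i then axis j 1 $ k else A $ k $ l) / det A"
proof -
  have "A *v (matrix_inv A *v axis j 1) = axis j 1"
    using matrix_inv_inverse[OF assms] by (simp add: matrix_vector_mul_assoc)
  then have "matrix_inv A *v axis j 1 =
      (\<chi> i. det (\<chi> k l. if l = i then axis j 1 $ k else A $ k $ l) / det A)"
    using cramer[OF assms] by blast
  moreover have "(matrix_inv A *v axis j 1) $ i = matrix_inv A $ i $ j"
    by (simp add: matrix_vector_mult_def axis_def if_distrib cong: if_cong)
  ultimately show ?thesis by simp
qed

lemma continuous_on_matrix_inv:
  fixes f :: "'a::topological_space \<Rightarrow> complex^'n^'n"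
  assumes "continuous_on S f" "\<And>x. x \<in> S \<Longrightarrow> det (f x) \<noteq> 0"
  shows "continuous_on S (\<lambda>x. matrix_inv (f x))"
proof -
  have "continuous_on S (\<lambda>x. if l = i then axis j 1 $ k else f x $ k $ l)" for i j k l
    using assms(1) by (cases "l = i") (auto intro!: continuous_on_component)
  then have "continuous_on S (\<lambda>x. \<chi> i j.
      det (\<chi> k l. if l = i then axis j 1 $ k else f x $ k $ l) / det (f x))"
    using assms
    by (intro continuous_on_vec_lambda continuous_on_divide continuous_on_det) auto
  then show ?thesis
    by (rule continuous_on_eq) (simp add: vec_eq_iff matrix_inv_cramer assms(2))
qed

lemma has_derivative_matrix_inv:
  fixes A :: "complex^'n^'n"
  assumes "det A \<noteq> 0"
  shows "(matrix_inv has_derivative (\<lambda>H. - (matrix_inv A ** H ** matrix_inv A))) (at A)"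
proof -
  let ?S = "{B :: complex^'n^'n. det B \<noteq> 0}"
  have "open ?S"
    using open_Collect_neq[of det "\<lambda>_. 0"] continuous_on_det[of UNIV "\<lambda>x. x"] by simp
  have "continuous_on ?S (matrix_inv :: complex^'n^'n \<Rightarrow> _)"
    by (rule continuous_on_matrix_inv) auto
  then have cont: "isCont matrix_inv A"
    using \<open>open ?S\<close> assms by (simp add: continuous_on_eq_continuous_at)
  obtain K where K: "K > 0" "\<And>(X :: complex^'n^'n) (Y :: complex^'n^'n). norm (X ** Y) \<le> norm X * norm Y * K"
    using matrix_mult.pos_bounded by blast
  \<comment> \<open>The remainder of the first-order expansion contains the factor
    \<open>B - A\<close> and one more factor that tends to 0 by continuity of the inverse, so it is
    o(|B - A|).\<close>
  have ident: "matrix_inv B - matrix_inv A + matrix_inv A ** (B - A) ** matrix_inv A =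
      (matrix_inv A - matrix_inv B) ** (B - A) ** matrix_inv A" if "det B \<noteq> 0" for B
  proof -
    have "matrix_inv B ** (B - A) ** matrix_inv A = matrix_inv A - matrix_inv B"
      using matrix_inv_inverse[OF that] matrix_inv_inverse[OF assms]
      by (simp add: matrix_linear_simps matrix_mul_assoc[symmetric])
    then show ?thesis by (simp add: matrix_mult.diff_left)
  qed
  have lim: "((\<lambda>B. norm (matrix_inv A - matrix_inv B) * (K * norm (matrix_inv A) * K)) \<longlongrightarrow> 0) (at A)"
    using cont by (auto simp: isCont_def intro!: tendsto_mult_left_zero tendsto_norm_zero
        tendsto_eq_intros)
  have "((\<lambda>B. norm (matrix_inv B - matrix_inv A - - (matrix_inv A ** (B - A) ** matrix_inv A)) /
      norm (B - A)) \<longlongrightarrow> 0) (at A)"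
  proof (rule Lim_null_comparison[OF _ lim])
    have "\<forall>\<^sub>F B in at A. B \<in> ?S"
      using \<open>open ?S\<close> assms eventually_at_in_open' by blast
    then show "\<forall>\<^sub>F B in at A. norm (norm (matrix_inv B - matrix_inv A -
        - (matrix_inv A ** (B - A) ** matrix_inv A)) / norm (B - A))
        \<le> norm (matrix_inv A - matrix_inv B) * (K * norm (matrix_inv A) * K)"
    proof eventually_elim
      case (elim B)
      have "norm ((matrix_inv A - matrix_inv B) ** (B - A) ** matrix_inv A) \<le>
          norm ((matrix_inv A - matrix_inv B) ** (B - A)) * norm (matrix_inv A) * K"
        by (rule K)
      also have "\<dots> \<le> (norm (matrix_inv A - matrix_inv B) * norm (B - A) * K) * norm (matrix_inv A) * K"
        using K by (intro mult_right_mono) auto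
      finally show ?case
        using ident[of B] elim K(1)
        by (cases "B = A") (simp_all add: divide_le_eq mult_ac)
    qed
  qed
  moreover have "bounded_linear (\<lambda>H. - (matrix_inv A ** H ** matrix_inv A))"
    by (intro bounded_linear_intros bounded_linear_minus
        bounded_linear_compose[OF matrix_mult.bounded_linear_left]
        matrix_mult.bounded_linear_right)
  ultimately show ?thesis
    using has_derivative_iff_norm by blast
qed

text \<open>The derivative is a product of the same inverse, taken twice, and the derivative of
  \<open>f\<close>, so the induction closes with \<open>f\<close> fixed.\<close>

lemma C_k_on_matrix_inv:
  fixes f :: "'a::euclidean_space \<Rightarrow> complex^'n^'n"
  assumes "open U" "C_k_on k U f" "\<And>x. x \<in> U \<Longrightarrow> det (f x) \<noteq> 0"
  shows "C_k_on k U (\<lambda>x. matrix_inv (f x))"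
  using assms(2)
proof (induction k)
  case 0
  then show ?case using assms(3) continuous_on_matrix_inv by auto
next
  case (Suc k)
  have der: "((\<lambda>x. matrix_inv (f x)) has_derivative
      (\<lambda>w. - (matrix_inv (f x) ** frechet_derivative f (at x) w ** matrix_inv (f x)))) (at x)"
    if "x \<in> U" for x
    using has_derivative_compose[OF C_k_on_has_derivative[OF Suc.prems that]
        has_derivative_matrix_inv[OF assms(3)[OF that]]] .
  have inv: "C_k_on k U (\<lambda>x. matrix_inv (f x))"
    using Suc C_k_on_SucD by blast
  have "C_k_on k U (\<lambda>x. - (matrix_inv (f x) ** frechet_derivative f (at x) w ** matrix_inv (f x)))" for w
    using Suc.prems inv assms(1)
    by (intro C_k_on_bounded_linear[OF _ bounded_linear_minus[OF bounded_linear_ident]]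
        C_k_on_bilinear[OF _ bounded_bilinear_matrix_mult]) auto
  from C_k_on_SucI[OF assms(1) der this] show ?case .
qed

section \<open>Tangent spaces of the complex special orthogonal group\<close>

lemma SO_C_D:
  assumes "p \<in> SO_C"
  shows "det p = 1" "p ** transpose p = mat 1" "transpose p ** p = mat 1"
    "p ** (transpose p ** X) = X" "transpose p ** (p ** X) = X" "matrix_inv p = transpose p"
proof -
  show 1: "det p = 1" "p ** transpose p = mat 1"
    using assms by (auto simp: SO_C_def)
  then show 2: "transpose p ** p = mat 1"
    using matrix_left_right_inverse by blast
  show "p ** (transpose p ** X) = X" "transpose p ** (p ** X) = X"
    using 1 2 by (simp_all add: matrix_mul_assoc)
  show "matrix_inv p = transpose p"
    using matrix_inv_unique 1 by blast
qed

lemma transpose_translate: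
  assumes "p \<in> SO_C" "transpose w ** p = - (transpose p ** w)"
  shows "transpose w = - (transpose p ** (w ** transpose p))"
proof -
  have "transpose w = (transpose w ** p) ** transpose p"
    using SO_C_D(2)[OF assms(1)] by (simp add: matrix_mul_assoc[symmetric])
  then show ?thesis
    unfolding assms(2) by (simp add: matrix_mult.minus_left matrix_mul_assoc)
qed

text \<open>
  The curve is \<open>p\<close> times the Cayley transform of \<open>(t / 2) Z\<close>, that is \<open>p N\<^sup>t N\<^sup>-\<^sup>1\<close> with
  \<open>N = 1 - (t / 2) Z\<close> and \<open>N\<^sup>t = 2 - N\<close>.
\<close>

lemma tangent_curve_SO_C:
  fixes p Z :: "complex^'n^'n"
  assumes p: "p \<in> SO_C" and Z: "transpose Z = - Z"
  shows "p ** Z \<in> tangent_space SO_C p"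
proof -
  define N where "N t = mat 1 - (t / 2) *\<^sub>R Z" for t :: real
  \<comment> \<open>With N^t = 2 - N the product N^t N^-1 equals 2 N^-1 - 1, so inversion is the
    only nonlinear ingredient. The derivative of the inverse of \<open>N\<close> at 0 is Z/2, which
    the factor 2 turns into \<open>Z\<close>.\<close>
  define \<gamma> where "\<gamma> t = p ** (2 *\<^sub>R matrix_inv (N t) - mat 1)" for t
  have derN: "(N has_derivative (\<lambda>w. - ((w / 2) *\<^sub>R Z))) (at t)" for t
  proof -
    have "((\<lambda>s. - ((s / 2) *\<^sub>R Z)) has_derivative (\<lambda>w. - ((w / 2) *\<^sub>R Z))) (at t)"
      by (intro bounded_linear_imp_has_derivative bounded_linear_minus
          bounded_linear_scaleR_const bounded_linear_divide)
    from has_derivative_add[OF has_derivative_const[of "mat 1"] this]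
    show ?thesis unfolding N_def[abs_def] by simp
  qed
  have contN: "continuous_on S N" for S
    by (intro continuous_at_imp_continuous_on ballI has_derivative_continuous[OF derN])
  have CN: "C_k_on k UNIV N" for k
  proof (cases k)
    case (Suc k')
    show ?thesis unfolding Suc by (rule C_k_on_SucI[OF open_UNIV derN C_k_on_const[OF open_UNIV]])
  qed (simp add: contN)
  have "open {t. det (N t) \<noteq> 0}"
    using open_Collect_neq[of "\<lambda>t. det (N t)" "\<lambda>_. 0"] continuous_on_det[OF contN] by simp
  moreover have "det (N 0) \<noteq> 0" by (simp add: N_def)
  ultimately obtain e where e: "e > 0" "ball 0 e \<subseteq> {t. det (N t) \<noteq> 0}"
    using open_contains_ball by blast
  have nz: "det (N t) \<noteq> 0" if "t \<in> {-e<..<e}" for t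
    using e that by (auto simp: subset_iff dist_real_def)
  have "\<gamma> t \<in> SO_C" if "t \<in> {-e<..<e}" for t
  proof -
    note inv = matrix_inv_inverse[OF nz[OF that]]
    let ?R = "matrix_inv (N t)"
    have Nt: "transpose (N t) = 2 *\<^sub>R mat 1 - N t"
      by (simp add: N_def matrix_linear_simps Z) (simp add: scaleR_2)
    have comm: "transpose (N t) ** N t = N t ** transpose (N t)"
      unfolding Nt by (simp add: matrix_linear_simps)
    define Q where "Q = transpose (N t) ** ?R"
    have "\<gamma> t = p ** Q"
      unfolding \<gamma>_def Q_def Nt using inv by (simp add: matrix_linear_simps)
    moreover have "det Q = 1"
    proof -
      have "det (N t) * det ?R = 1" using inv det_mul det_I by metis
      then show ?thesis unfolding Q_def by (simp add: det_mul)
    qed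
    \<comment> \<open>\<open>N t\<close> commutes with its transpose, both being polynomials in
      \<open>Z\<close>; hence Q^t Q regroups into the product of N N^-1 with its own
      transpose.\<close>
    moreover have "Q ** transpose Q = mat 1"
    proof -
      have "transpose Q ** Q = transpose ?R ** (N t ** transpose (N t)) ** ?R"
        by (simp add: Q_def matrix_transpose_mul matrix_mul_assoc)
      also have "\<dots> = transpose (N t ** ?R) ** (N t ** ?R)"
        unfolding comm[symmetric] by (simp add: matrix_transpose_mul matrix_mul_assoc)
      finally have "transpose Q ** Q = mat 1" using inv by simp
      then show ?thesis using matrix_left_right_inverse by blast
    qed
    moreover have "(p ** Q) ** transpose (p ** Q) = p ** (Q ** transpose Q) ** transpose p"
      by (simp add: matrix_transpose_mul matrix_mul_assoc)
    ultimately show ?thesis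
      using SO_C_D[OF p] unfolding SO_C_def by (simp add: det_mul)
  qed
  moreover have "N 0 = mat 1" by (simp add: N_def)
  then have "matrix_inv (N 0) = mat 1" using matrix_inv_unique[of "mat 1" "mat 1"] by simp
  then have "\<gamma> 0 = p" by (simp add: \<gamma>_def scaleR_2)
  moreover have "(\<gamma> has_vector_derivative p ** Z) (at 0)"
  proof -
    have "((\<lambda>t. matrix_inv (N t)) has_derivative
        (\<lambda>w. - (matrix_inv (N 0) ** - ((w / 2) *\<^sub>R Z) ** matrix_inv (N 0)))) (at 0)"
      by (rule has_derivative_compose[OF derN has_derivative_matrix_inv]) (simp add: N_def)
    then have "((\<lambda>t. matrix_inv (N t)) has_derivative (\<lambda>w. (w / 2) *\<^sub>R Z)) (at 0)"
      using \<open>matrix_inv (N 0) = mat 1\<close> by (simp add: matrix_linear_simps)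
    then have "((\<lambda>t. 2 *\<^sub>R matrix_inv (N t) - mat 1) has_derivative (\<lambda>w. w *\<^sub>R Z)) (at 0)"
      by (auto intro!: derivative_eq_intros)
    from bounded_linear.has_derivative[OF matrix_mult.bounded_linear_right this]
    show ?thesis
      unfolding has_vector_derivative_def \<gamma>_def[abs_def] by (simp add: matrix_linear_simps)
  qed
  moreover have "smooth_on_open {-e<..<e} \<gamma>"
    unfolding smooth_on_open_def
  proof
    fix k
    have "C_k_on k {-e<..<e} (\<lambda>t. matrix_inv (N t))"
      by (rule C_k_on_matrix_inv) (use nz C_k_on_subset[OF CN] in auto)
    from C_k_on_add[OF _ C_k_on_bounded_linear[OF _ bounded_linear_scaleR_right[of 2] this]
        C_k_on_const[of _ _ "- mat 1"]]
    have "C_k_on k {-e<..<e} (\<lambda>t. 2 *\<^sub>R matrix_inv (N t) - mat 1)" by simp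
    from C_k_on_bounded_linear[OF _ matrix_mult.bounded_linear_right this]
    show "C_k_on k {-e<..<e} \<gamma>" unfolding \<gamma>_def[abs_def] by simp
  qed
  ultimately show ?thesis
    using e(1) unfolding tangent_space_def by blast
qed

text \<open>Differentiating \<open>transpose (\<gamma> t) ** \<gamma> t = mat 1\<close> gives one
  inclusion. Conversely such a \<open>w\<close> is \<open>p ** Z\<close> with the skew matrix
  \<open>Z = transpose p ** w\<close>, hence the velocity of a Cayley curve. Linearity of the
  tangent space, not visible from its definition by curves, follows.\<close>

lemma tangent_space_SO_C:
  fixes p :: "complex^'n^'n"
  assumes p: "p \<in> SO_C"
  shows "tangent_space SO_C p = {w. transpose w ** p = - (transpose p ** w)}"
proof (intro set_eqI iffI CollectI; (elim CollectE)?)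
  fix w assume "w \<in> tangent_space SO_C p"
  then obtain \<gamma> e where e: "e > 0" "\<gamma> ` {-e<..<e} \<subseteq> SO_C" "\<gamma> 0 = p"
    and \<gamma>: "(\<gamma> has_vector_derivative w) (at 0)"
    unfolding tangent_space_def by blast
  have "((\<lambda>t. transpose (\<gamma> t) ** \<gamma> t) has_vector_derivative
      (transpose (\<gamma> 0) ** w + transpose w ** \<gamma> 0)) (at 0)"
    by (intro bounded_bilinear.has_vector_derivative[OF bounded_bilinear_matrix_mult]
        bounded_linear.has_vector_derivative[OF bounded_linear_transpose] \<gamma>)
  then have "((\<lambda>t. mat 1) has_vector_derivative (transpose (\<gamma> 0) ** w + transpose w ** \<gamma> 0)) (at 0)"
    by (rule has_vector_derivative_transform_within_open[where S = "{-e<..<e}"])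
       (use e in \<open>auto simp: image_subset_iff SO_C_D(3)\<close>)
  then have "transpose p ** w + transpose w ** p = 0"
    using vector_derivative_unique_at has_vector_derivative_const e(3) by blast
  then show "transpose w ** p = - (transpose p ** w)"
    by (simp add: add_eq_0_iff)
next
  fix w assume w: "transpose w ** p = - (transpose p ** w)"
  have "p ** (transpose p ** w) \<in> tangent_space SO_C p"
    by (rule tangent_curve_SO_C[OF p]) (simp add: matrix_transpose_mul w)
  then show "w \<in> tangent_space SO_C p"
    by (simp add: SO_C_D[OF p])
qed

section \<open>Levi-Civita connections and divergences\<close>

lemma levi_civitaD:
  assumes "levi_civita M g D" "vector_field M X" "vector_field M Y"
  shows "vector_field M (D X Y)"
    and "p \<in> M \<Longrightarrow> D X Y p - D Y X p = lie_bracket M X Y p"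
    and "vector_field M Z \<Longrightarrow> p \<in> M \<Longrightarrow>
      differential M (\<lambda>q. g q (Y q) (Z q)) p (X p) = g p (D X Y p) (Z p) + g p (Y p) (D X Z p)"
  using assms unfolding levi_civita_def by simp_all

text \<open>
  The difference of two Levi-Civita connections is symmetric in its two arguments and
  skew-adjoint with respect to the second one; a trilinear form with these symmetries vanishes.
\<close>

lemma levi_civita_unique:
  assumes "levi_civita M g D" "levi_civita M g D'"
    and extend: "\<And>p w. p \<in> M \<Longrightarrow> w \<in> tangent_space M p \<Longrightarrow> \<exists>V. vector_field M V \<and> V p = w"
    and sym: "\<And>p X Y. p \<in> M \<Longrightarrow> g p X Y = g p Y X"
    and diff: "\<And>p X X' Y. p \<in> M \<Longrightarrow> g p (X - X') Y = g p X Y - g p X' Y"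
    and nondegenerate: "\<And>p X X'. p \<in> M \<Longrightarrow> X \<in> tangent_space M p \<Longrightarrow> X' \<in> tangent_space M p \<Longrightarrow>
      (\<And>Y. Y \<in> tangent_space M p \<Longrightarrow> g p X Y = g p X' Y) \<Longrightarrow> X = X'"
    and X: "vector_field M X" and Y: "vector_field M Y" and p: "p \<in> M"
  shows "D X Y p = D' X Y p"
proof -
  define s where "s X Y Z = g p (D X Y p - D' X Y p) (Z p)" for X Y Z
  have swap: "s X Y Z = s Y X Z" if "vector_field M X" "vector_field M Y" for X Y Z
  proof -
    have "D X Y p - D Y X p = D' X Y p - D' Y X p"
      using levi_civitaD(2)[OF assms(1) that p] levi_civitaD(2)[OF assms(2) that p] by simp
    then have "D X Y p - D' X Y p = D Y X p - D' Y X p"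
      by (simp add: algebra_simps)
    then show ?thesis unfolding s_def by simp
  qed
  have skew: "s X Y Z = - s X Z Y"
    if "vector_field M X" "vector_field M Y" "vector_field M Z" for X Y Z
  proof -
    have "g p (D X Y p) (Z p) + g p (Y p) (D X Z p) =
        g p (D' X Y p) (Z p) + g p (Y p) (D' X Z p)"
      using levi_civitaD(3)[OF assms(1) that p] levi_civitaD(3)[OF assms(2) that p] by simp
    then show ?thesis
      unfolding s_def diff[OF p] sym[OF p, of "Y p"] by simp
  qed
  \<comment> \<open>Skew-adjointness and symmetry are applied alternately, three times each. This
    runs once through all orders of the three fields and returns to the start with sign -1, so
    \<open>s X Y Z = - s X Y Z\<close>.\<close>
  have zero: "s X Y Z = 0" if Z: "vector_field M Z" for Z
    using skew[OF X Y Z] swap[OF X Z, of Y] skew[OF Z X Y] swap[OF Z Y, of X] skew[OF Y Z X]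
      swap[OF Y X, of Z] by simp
  have tangent: "D X Y p \<in> tangent_space M p" "D' X Y p \<in> tangent_space M p"
    using levi_civitaD(1)[OF assms(1) X Y] levi_civitaD(1)[OF assms(2) X Y] p
    unfolding vector_field_def by auto
  show ?thesis
  proof (rule nondegenerate[OF p tangent])
    fix w assume "w \<in> tangent_space M p"
    then obtain Z where "vector_field M Z" "Z p = w" using extend p by blast
    then show "g p (D X Y p) w = g p (D' X Y p) w"
      using zero[of Z] unfolding s_def diff[OF p] by simp
  qed
qed

text \<open>The trace of an endomorphism of \<open>T\<close> is the ambient trace of its composition
  with any projection \<open>P\<close> onto \<open>T\<close>, orthogonal or not. \<open>L'\<close>
  may differ from \<open>L\<close> off \<open>T\<close>, as a covariant derivative is meaningful on
  tangent vectors only.\<close>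

lemma trace_on_eq_sum_Basis:
  fixes L P :: "'a::euclidean_space \<Rightarrow> 'a"
  assumes "subspace T" "linear P" "linear L"
    and P: "\<And>x. P x \<in> T" "\<And>x. x \<in> T \<Longrightarrow> P x = x"
    and L: "\<And>x. x \<in> T \<Longrightarrow> L x \<in> T"
    and L': "\<And>x. x \<in> T \<Longrightarrow> L' x = L x"
  shows "trace_on T L' = (\<Sum>b\<in>Basis. L (P b) \<bullet> b)"
proof -
  define B where "B = (SOME B. independent B \<and> span B = T)"
  have "\<exists>B. independent B \<and> span B = T"
    using basis_exists[of T] assms(1) span_eq_iff span_mono by (metis subset_antisym)
  then have B: "independent B" "span B = T"
    unfolding B_def by (metis (mono_tags, lifting) someI_ex)+
  have fin: "finite B" using independent_imp_finite[OF B(1)] .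
  have rep: "representation B (L' b) b = (\<Sum>c\<in>Basis. (b \<bullet> c) * representation B (L (P c)) b)"
    if "b \<in> B" for b
  proof -
    have "b \<in> T" using that B(2) span_base by blast
    then have "L' b = L (P b)" using P L' by simp
    also have "\<dots> = L (P (\<Sum>c\<in>Basis. (b \<bullet> c) *\<^sub>R c))"
      by (simp add: euclidean_representation)
    also have "\<dots> = (\<Sum>c\<in>Basis. (b \<bullet> c) *\<^sub>R L (P c))"
      using assms(2,3) by (simp add: linear_sum linear_cmul)
    finally have "representation B (L' b) = representation B (\<Sum>c\<in>Basis. (b \<bullet> c) *\<^sub>R L (P c))"
      by simp
    also have "\<dots> = (\<lambda>x. \<Sum>c\<in>Basis. representation B ((b \<bullet> c) *\<^sub>R L (P c)) x)"
      using B P L by (intro representation_sum) (auto intro: subspace_scale assms(1))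
    also have "\<dots> = (\<lambda>x. \<Sum>c\<in>Basis. (b \<bullet> c) * representation B (L (P c)) x)"
      using B P L by (simp add: representation_scale)
    finally show ?thesis by simp
  qed
  have "trace_on T L' = (\<Sum>b\<in>B. representation B (L' b) b)"
    unfolding trace_on_def B_def Let_def ..
  also have "\<dots> = (\<Sum>b\<in>B. \<Sum>c\<in>Basis. (b \<bullet> c) * representation B (L (P c)) b)"
    using rep by simp
  also have "\<dots> = (\<Sum>c\<in>Basis. (\<Sum>b\<in>B. representation B (L (P c)) b *\<^sub>R b) \<bullet> c)"
    by (subst sum.swap) (simp add: inner_sum_left mult.commute)
  also have "\<dots> = (\<Sum>c\<in>Basis. L (P c) \<bullet> c)"
    using B P L by (simp add: sum_representation_eq fin)
  finally show ?thesis .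
qed

section \<open>The Levi-Civita connection of the complex special orthogonal group\<close>

lemma trace_transpose: "trace (transpose A) = trace A"
  by (simp add: trace_def transpose_def)

lemma SO_metric_diff_left:
  "SO_metric p (X - X') Y = SO_metric p X Y - SO_metric p X' Y"
  by (simp add: SO_metric_def matrix_linear_simps)

lemma SO_metric_commute: "SO_metric p X Y = SO_metric p Y X"
  unfolding SO_metric_def by (subst trace_mul_sym) (rule refl)

text \<open>
  The metric is the restriction of a form on the ambient space that does not depend on the
  point: its Levi-Civita connection is the tangential part of the flat one.
\<close>

lemma SO_metric_tangent:
  fixes p :: "complex^'n^'n"
  assumes p: "p \<in> SO_C" and X: "X \<in> tangent_space SO_C p"
  shows "SO_metric p X Y = Re (trace (transpose X ** Y))"
proof -
  have "transpose p ** X = - (transpose X ** p)"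
    using X tangent_space_SO_C[OF p] by simp
  then have "(transpose p ** X) ** (transpose p ** Y) = - (transpose X ** (p ** (transpose p ** Y)))"
    by (simp add: matrix_linear_simps matrix_mul_assoc)
  then show ?thesis
    unfolding SO_metric_def SO_C_D(6)[OF p] by (simp add: matrix_linear_simps SO_C_D[OF p])
qed

text \<open>The product in question is the symmetric \<open>S\<close> times the skew
  \<open>transpose p ** Y\<close>, and such products have trace zero. So the matrices
  \<open>p ** S\<close> are normal to the group for the ambient form.\<close>

lemma trace_symmetric_mult_tangent:
  fixes p :: "complex^'n^'n"
  assumes p: "p \<in> SO_C" and Y: "Y \<in> tangent_space SO_C p" and S: "transpose S = S"
  shows "trace (transpose (p ** S) ** Y) = 0"
proof -
  let ?Z = "transpose p ** Y"
  have "transpose ?Z = - ?Z"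
    using Y tangent_space_SO_C[OF p] by (simp add: matrix_transpose_mul)
  then have "trace (S ** ?Z) = - trace (S ** ?Z)"
    using trace_transpose[of "S ** ?Z"] S trace_mul_sym[of ?Z S]
    by (simp add: matrix_transpose_mul matrix_linear_simps)
  then show ?thesis
    by (simp add: matrix_transpose_mul S matrix_mul_assoc)
qed

text \<open>The form is indefinite in general, so pairing \<open>X - X'\<close> with itself does not
  help. The entrywise conjugate of a skew matrix is again skew, and pairing \<open>Z\<close> with
  its conjugate gives the sum of all |Z_ij|^2.\<close>

lemma SO_metric_nondegenerate:
  fixes p :: "complex^'n^'n"
  assumes p: "p \<in> SO_C" and "X \<in> tangent_space SO_C p" "X' \<in> tangent_space SO_C p"
    and eq: "\<And>Y. Y \<in> tangent_space SO_C p \<Longrightarrow> SO_metric p X Y = SO_metric p X' Y"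
  shows "X = X'"
proof -
  define Z where "Z = transpose p ** (X - X')"
  define W where "W = (\<chi> i j. cnj (Z $ i $ j))"
  have tZ: "transpose Z = - Z"
    using assms(2,3) tangent_space_SO_C[OF p]
    by (simp add: Z_def matrix_transpose_mul matrix_linear_simps)
  have neg: "Z $ j $ i = - Z $ i $ j" for i j
    using arg_cong[OF tZ, of "\<lambda>A. A $ i $ j"] by (simp add: transpose_def)
  have "transpose W $ i $ j = (- W) $ i $ j" for i j
    using neg[of j i] by (simp add: W_def transpose_def)
  then have "transpose W = - W"
    by (simp add: vec_eq_iff)
  then have "p ** W \<in> tangent_space SO_C p"
    by (rule tangent_curve_SO_C[OF p])
  then have "SO_metric p (X - X') (p ** W) = 0"
    unfolding SO_metric_diff_left by (simp add: eq)
  then have "Re (trace (Z ** W)) = 0"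
    unfolding SO_metric_def SO_C_D(6)[OF p] by (simp add: SO_C_D[OF p] Z_def)
  moreover have "trace (Z ** W) = - (\<Sum>i\<in>UNIV. \<Sum>j\<in>UNIV. Z $ i $ j * cnj (Z $ i $ j))"
  proof -
    have "Z $ i $ j * cnj (Z $ j $ i) = - (Z $ i $ j * cnj (Z $ i $ j))" for i j
      using neg[of j i] by simp
    then show ?thesis
      by (simp add: trace_def matrix_matrix_mult_def W_def sum_negf)
  qed
  moreover have "(\<Sum>i\<in>UNIV. \<Sum>j\<in>UNIV. Z $ i $ j * cnj (Z $ i $ j)) =
      of_real (\<Sum>i\<in>UNIV. \<Sum>j\<in>UNIV. (cmod (Z $ i $ j))\<^sup>2)"
    unfolding of_real_sum by (intro sum.cong refl) (rule complex_norm_square[symmetric])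
  ultimately have "(\<Sum>i\<in>UNIV. \<Sum>j\<in>UNIV. (cmod (Z $ i $ j))\<^sup>2) = 0"
    by (simp only: uminus_complex.sel Re_complex_of_real neg_equal_0_iff_equal)
  then have "Z = 0"
    by (simp add: sum_nonneg_eq_0_iff sum_nonneg vec_eq_iff)
  then have "p ** Z = 0" by simp
  then show ?thesis
    by (simp add: Z_def SO_C_D[OF p])
qed

definition SO_connection ::
  "(complex^'n^'n \<Rightarrow> complex^'n^'n) \<Rightarrow> (complex^'n^'n \<Rightarrow> complex^'n^'n) \<Rightarrow> complex^'n^'n \<Rightarrow> complex^'n^'n"
  where "SO_connection X Y p = differential SO_C Y p (X p)
    + (1/2) *\<^sub>R (p ** (transpose (X p) ** Y p + transpose (Y p) ** X p))"

lemma left_invariant_vector_field: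
  fixes Z :: "complex^'n^'n"
  assumes "transpose Z = - Z"
  shows "vector_field SO_C (\<lambda>p. p ** Z)"
  unfolding vector_field_def
  using smooth_linear[OF matrix_mult.bounded_linear_left] tangent_curve_SO_C assms by blast

text \<open>Left-invariant fields give global extensions, without cut-off functions.\<close>

lemma extend_tangent_SO_C:
  fixes p :: "complex^'n^'n"
  assumes p: "p \<in> SO_C" and w: "w \<in> tangent_space SO_C p"
  shows "\<exists>V. vector_field SO_C V \<and> V p = w"
proof (intro exI conjI)
  have "transpose (transpose p ** w) = - (transpose p ** w)"
    using w tangent_space_SO_C[OF p] by (simp add: matrix_transpose_mul)
  then show "vector_field SO_C (\<lambda>q. q ** (transpose p ** w))"
    by (rule left_invariant_vector_field)
  show "p ** (transpose p ** w) = w"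
    by (rule SO_C_D(4)[OF p])
qed

text \<open>This is the tangency condition
  \<open>transpose (Y q) ** q + transpose q ** Y q = 0\<close> differentiated along
  \<open>w\<close>. The non-tangential part of the derivative of \<open>Y\<close> thus depends only
  on \<open>Y p\<close> and \<open>w\<close>, which dictates the correction term of
  \<open>SO_connection\<close>.\<close>

lemma vector_field_SO_C_differential:
  fixes Y :: "complex^'n^'n \<Rightarrow> complex^'n^'n"
  assumes Y: "vector_field SO_C Y" and p: "p \<in> SO_C" and w: "w \<in> tangent_space SO_C p"
  shows "transpose (differential SO_C Y p w) ** p + transpose p ** differential SO_C Y p w =
    - (transpose (Y p) ** w + transpose w ** Y p)"
proof -
  have group: "b + c = - (a + d) \<longleftrightarrow> a + b + (c + d) = 0" for a b c d :: "complex^'n^'n"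
    by (simp add: eq_neg_iff_add_eq_0 add_ac del: minus_add_distrib)
  have sY: "smooth SO_C Y" using Y unfolding vector_field_def by blast
  have st: "smooth SO_C (transpose :: complex^'n^'n \<Rightarrow> _)"
    by (rule smooth_linear[OF bounded_linear_transpose])
  have stY: "smooth SO_C (\<lambda>q. transpose (Y q))"
    by (rule smooth_bounded_linear[OF bounded_linear_transpose sY])
  have si: "smooth SO_C (\<lambda>q::complex^'n^'n. q)"
    by (rule smooth_linear[OF bounded_linear_ident])
  have dt: "differential SO_C transpose p w = transpose w"
    and di: "differential SO_C (\<lambda>q. q) p w = w"
    and dY: "differential SO_C (\<lambda>q. transpose (Y q)) p w = transpose (differential SO_C Y p w)"
    using differential_eq[OF _ w] bounded_linear_imp_has_derivative[OF bounded_linear_transpose]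
      bounded_linear.has_derivative[OF bounded_linear_transpose smooth_imp_has_derivative[OF sY p]]
    unfolding differential_def by (auto intro: has_derivative_ident)
  have "differential SO_C (\<lambda>q. transpose (Y q) ** q + transpose q ** Y q) p w =
      transpose (Y p) ** w + transpose (differential SO_C Y p w) ** p +
      (transpose p ** differential SO_C Y p w + transpose w ** Y p)"
    using differential_add[OF smooth_bilinear[OF bounded_bilinear_matrix_mult stY si]
        smooth_bilinear[OF bounded_bilinear_matrix_mult st sY] p w]
      differential_bilinear[OF bounded_bilinear_matrix_mult stY si p w]
      differential_bilinear[OF bounded_bilinear_matrix_mult st sY p w]
    unfolding dt di dY by simp
  moreover have "differential SO_C (\<lambda>q. transpose (Y q) ** q + transpose q ** Y q) p w =
      differential SO_C (\<lambda>q. 0) p w"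
  proof (rule differential_cong[OF smooth_const p w])
    fix q :: "complex^'n^'n" assume "q \<in> SO_C"
    then show "transpose (Y q) ** q + transpose q ** Y q = 0"
      using Y tangent_space_SO_C unfolding vector_field_def by fastforce
  qed
  moreover have "differential SO_C (\<lambda>q. 0 :: complex^'n^'n) p w = 0"
    using differential_eq[OF has_derivative_const w] .
  ultimately have "transpose (Y p) ** w + transpose (differential SO_C Y p w) ** p +
      (transpose p ** differential SO_C Y p w + transpose w ** Y p) = 0"
    by simp
  then show ?thesis
    unfolding group by blast
qed

lemma SO_connection_tangent:
  assumes X: "vector_field SO_C X" and Y: "vector_field SO_C Y" and p: "p \<in> SO_C"
  shows "SO_connection X Y p \<in> tangent_space SO_C p"
proof -
  let ?D = "differential SO_C Y p (X p)" and ?S = "transpose (X p) ** Y p + transpose (Y p) ** X p"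
  have "X p \<in> tangent_space SO_C p"
    using X p unfolding vector_field_def by blast
  then have "transpose ?D ** p + transpose p ** ?D = - ?S"
    using vector_field_SO_C_differential[OF Y p] by (simp add: add.commute)
  moreover have "transpose (p ** ?S) = ?S ** transpose p"
    by (simp add: matrix_transpose_mul matrix_linear_simps add.commute)
  then have "transpose (p ** ?S) ** p = ?S"
    by (simp add: matrix_mul_assoc[symmetric] SO_C_D[OF p])
  moreover have "transpose p ** (p ** ?S) = ?S"
    by (rule SO_C_D[OF p])
  ultimately have "transpose (SO_connection X Y p) ** p + transpose p ** SO_connection X Y p = 0"
    unfolding SO_connection_def transpose_linear_simps matrix_mult.add_left matrix_mult.add_right
      matrix_mult.scaleR_left matrix_mult.scaleR_right
    by (simp add: algebra_simps flip: scaleR_left_distrib)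
  then show ?thesis
    unfolding tangent_space_SO_C[OF p] by (simp add: add_eq_0_iff2)
qed

lemma vector_field_SO_connection:
  assumes X: "vector_field SO_C X" and Y: "vector_field SO_C Y"
  shows "vector_field SO_C (SO_connection X Y)"
  unfolding vector_field_def
proof
  have sX: "smooth SO_C X" and sY: "smooth SO_C Y" using X Y unfolding vector_field_def by auto
  show "smooth SO_C (SO_connection X Y)"
    unfolding SO_connection_def[abs_def]
    by (intro smooth_add smooth_differential smooth_bounded_linear[OF bounded_linear_scaleR_right]
        smooth_bilinear[OF bounded_bilinear_matrix_mult]
        smooth_bounded_linear[OF bounded_linear_transpose] sX sY X smooth_linear[OF bounded_linear_ident])
  show "\<forall>p\<in>SO_C. SO_connection X Y p \<in> tangent_space SO_C p"
    using SO_connection_tangent[OF X Y] by blast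
qed

text \<open>The correction term is \<open>p\<close> times a symmetric matrix, hence normal. Metric
  compatibility therefore reduces to the product rule for the constant ambient form.\<close>

lemma SO_metric_SO_connection:
  assumes X: "vector_field SO_C X" and Y: "vector_field SO_C Y" and p: "p \<in> SO_C"
    and Z: "Z \<in> tangent_space SO_C p"
  shows "SO_metric p (SO_connection X Y p) Z = Re (trace (transpose (differential SO_C Y p (X p)) ** Z))"
proof -
  let ?S = "transpose (X p) ** Y p + transpose (Y p) ** X p"
  have "trace (transpose (p ** ?S) ** Z) = 0"
    by (rule trace_symmetric_mult_tangent[OF p Z])
       (simp add: matrix_transpose_mul matrix_linear_simps add.commute)
  then show ?thesis
    unfolding SO_metric_tangent[OF p SO_connection_tangent[OF X Y p]]
    unfolding SO_connection_def transpose_linear_simps matrix_mult.add_left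
      matrix_mult.scaleR_left trace_linear_simps by simp
qed

lemma levi_civita_SO_connection:
  "levi_civita SO_C SO_metric (SO_connection :: (complex^'n^'n \<Rightarrow> _) \<Rightarrow> _)"
  unfolding levi_civita_def
proof (intro conjI allI impI ballI; (elim conjE)?)
  fix X X' Y :: "complex^'n^'n \<Rightarrow> complex^'n^'n" and p :: "complex^'n^'n"
    and f :: "complex^'n^'n \<Rightarrow> real"
  assume X: "vector_field SO_C X" and Y: "vector_field SO_C Y"
  then have sX: "smooth SO_C X" and sY: "smooth SO_C Y"
    unfolding vector_field_def by auto
  show "vector_field SO_C (SO_connection X Y)"
    by (rule vector_field_SO_connection[OF X Y])
  assume p: "p \<in> SO_C"
  have Xp: "X p \<in> tangent_space SO_C p"
    using X p unfolding vector_field_def by blast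
  note lin = linear_differential[OF sY p]
  show "SO_connection (\<lambda>q. X q + X' q) Y p = SO_connection X Y p + SO_connection X' Y p"
    unfolding SO_connection_def linear_add[OF lin]
    by (simp add: matrix_linear_simps algebra_simps)
  show "SO_connection (\<lambda>q. f q *\<^sub>R X q) Y p = f p *\<^sub>R SO_connection X Y p"
    unfolding SO_connection_def linear_cmul[OF lin]
    by (simp add: matrix_linear_simps algebra_simps)
  \<comment> \<open>The correction term is symmetric in \<open>X\<close> and \<open>Y\<close> and
    cancels.\<close>
  show "SO_connection X Y p - SO_connection Y X p = lie_bracket SO_C X Y p"
    unfolding SO_connection_def lie_bracket_def by (simp add: add.commute)
  {
    assume f: "smooth SO_C f"
    show "SO_connection X (\<lambda>q. f q *\<^sub>R Y q) p =
        differential SO_C f p (X p) *\<^sub>R Y p + f p *\<^sub>R SO_connection X Y p"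
      unfolding SO_connection_def
        differential_bilinear[OF bounded_bilinear_scaleR f sY p Xp]
      by (simp add: matrix_linear_simps algebra_simps)
  }
  {
    fix Z :: "complex^'n^'n \<Rightarrow> complex^'n^'n"
    assume Z: "vector_field SO_C Z"
    then have sZ: "smooth SO_C Z" unfolding vector_field_def by blast
    have Yq: "Y q \<in> tangent_space SO_C q" and Zq: "Z q \<in> tangent_space SO_C q" if "q \<in> SO_C" for q
      using Y Z that unfolding vector_field_def by auto
    show "SO_connection X (\<lambda>q. Y q + Z q) p = SO_connection X Y p + SO_connection X Z p"
      unfolding SO_connection_def differential_add[OF sY sZ p Xp]
      by (simp add: matrix_linear_simps algebra_simps)
    have bil: "bounded_bilinear (\<lambda>A B :: complex^'n^'n. Re (trace (transpose A ** B)))"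
      unfolding bilinear_conv_bounded_bilinear[symmetric] bilinear_def
      by (auto intro!: linearI simp: matrix_linear_simps)
    \<comment> \<open>\<open>SO_metric\<close> contains the inverse of \<open>q\<close>. It is
      replaced by the constant form before differentiating, since \<open>differential\<close> sees
      only values on \<open>SO_C\<close>.\<close>
    have "differential SO_C (\<lambda>q. SO_metric q (Y q) (Z q)) p (X p) =
        differential SO_C (\<lambda>q. Re (trace (transpose (Y q) ** Z q))) p (X p)"
      by (rule differential_cong[OF smooth_bilinear[OF bil sY sZ] p Xp])
         (simp add: SO_metric_tangent Yq)
    also have "\<dots> = Re (trace (transpose (Y p) ** differential SO_C Z p (X p))) +
        Re (trace (transpose (differential SO_C Y p (X p)) ** Z p))"
      by (rule differential_bilinear[OF bil sY sZ p Xp])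
    also have "Re (trace (transpose (Y p) ** differential SO_C Z p (X p))) =
        Re (trace (transpose (differential SO_C Z p (X p)) ** Y p))"
      by (subst trace_transpose[symmetric]) (simp add: matrix_transpose_mul)
    finally show "differential SO_C (\<lambda>q. SO_metric q (Y q) (Z q)) p (X p) =
        SO_metric p (SO_connection X Y p) (Z p) + SO_metric p (Y p) (SO_connection X Z p)"
      unfolding SO_metric_SO_connection[OF X Y p Zq[OF p]] SO_metric_commute[of p "Y p"]
        SO_metric_SO_connection[OF X Z p Yq[OF p]] by simp
  }
qed

section \<open>Gradients and divergences of linear functions\<close>

text \<open>For \<open>p\<close> in the group this is \<open>p\<close> times the skew part of
  \<open>transpose p ** w\<close>: the projection onto the tangent space along the normal matrices
  \<open>p ** S\<close>, with \<open>S\<close> symmetric.\<close>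

definition SO_projection :: "complex^'n^'n \<Rightarrow> complex^'n^'n \<Rightarrow> complex^'n^'n" where
  "SO_projection p w = (1/2) *\<^sub>R (w - p ** (transpose w ** p))"

lemma linear_SO_projection: "linear (SO_projection p)"
  by (rule linearI) (simp_all add: SO_projection_def matrix_linear_simps algebra_simps)

lemma SO_projection_tangent:
  assumes p: "p \<in> SO_C"
  shows "SO_projection p w \<in> tangent_space SO_C p"
proof -
  have "transpose (p ** (transpose w ** p)) ** p = transpose p ** w"
    by (simp add: matrix_transpose_mul matrix_mul_assoc[symmetric] SO_C_D[OF p])
  then show ?thesis
    unfolding tangent_space_SO_C[OF p]
    by (simp add: SO_projection_def matrix_linear_simps SO_C_D[OF p] algebra_simps)
qed

lemma SO_projection_eq:
  assumes p: "p \<in> SO_C" and w: "w \<in> tangent_space SO_C p"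
  shows "SO_projection p w = w"
proof -
  have "transpose w ** p = - (transpose p ** w)"
    using w tangent_space_SO_C[OF p] by blast
  then show ?thesis
    by (simp add: SO_projection_def matrix_linear_simps SO_C_D[OF p] flip: scaleR_2)
qed

text \<open>\<open>A\<close> minus its projection is \<open>p\<close> times the symmetric part of
  \<open>transpose p ** A\<close>, which pairs to zero with tangent vectors.\<close>

lemma SO_metric_projection:
  fixes p :: "complex^'n^'n"
  assumes p: "p \<in> SO_C" and Y: "Y \<in> tangent_space SO_C p"
  shows "SO_metric p (SO_projection p A) Y = Re (trace (transpose A ** Y))"
proof -
  define S where "S = (1/2) *\<^sub>R (transpose p ** A + transpose A ** p)"
  have "transpose S = S"
    by (simp add: S_def matrix_linear_simps matrix_transpose_mul add.commute)
  then have "trace (transpose (p ** S) ** Y) = 0"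
    by (rule trace_symmetric_mult_tangent[OF p Y])
  moreover have A: "A = SO_projection p A + p ** S"
  proof -
    have "SO_projection p A + p ** S = (1/2) *\<^sub>R A + (1/2) *\<^sub>R A"
      by (simp add: SO_projection_def S_def matrix_linear_simps SO_C_D[OF p] algebra_simps)
    then show ?thesis by (simp flip: scaleR_left_distrib)
  qed
  moreover have "trace (transpose A ** Y) =
      trace (transpose (SO_projection p A) ** Y) + trace (transpose (p ** S) ** Y)"
    by (subst A) (simp only: matrix_linear_simps)
  ultimately show ?thesis
    using SO_metric_tangent[OF p SO_projection_tangent[OF p]] by simp
qed

lemma bounded_linear_trace_mult: "bounded_linear (\<lambda>q :: complex^'n^'n. trace (A ** q))"
  using bounded_linear_compose[OF bounded_linear_trace matrix_mult.bounded_linear_right] .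

text \<open>\<open>f\<close> is prescribed on \<open>SO_C\<close> only, because
  \<open>\<phi>_fun\<close> is set to 0 elsewhere. Nondegeneracy supplies the uniqueness behind
  \<open>THE\<close>.\<close>

lemma gradient_linear_function:
  fixes A p :: "complex^'n^'n"
  assumes f: "\<And>q. q \<in> SO_C \<Longrightarrow> f q = Re (trace (transpose A ** q))" and p: "p \<in> SO_C"
  shows "gradient SO_C SO_metric f p = SO_projection p A"
proof -
  have "bounded_linear (\<lambda>q. Re (trace (transpose A ** q)))"
    using bounded_linear_compose[OF bounded_linear_Re bounded_linear_trace_mult] .
  then have "((\<lambda>q. Re (trace (transpose A ** q))) has_derivative (\<lambda>q. Re (trace (transpose A ** q))))
      (at p within SO_C)"
    by (rule bounded_linear_imp_has_derivative)
  then have "(f has_derivative (\<lambda>q. Re (trace (transpose A ** q)))) (at p within SO_C)"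
    by (rule has_derivative_transform[OF p, rotated]) (rule f)
  then have df: "differential SO_C f p Y = Re (trace (transpose A ** Y))"
    if "Y \<in> tangent_space SO_C p" for Y
    using differential_eq that by blast
  show ?thesis
    unfolding gradient_def
  proof (rule the_equality)
    show "SO_projection p A \<in> tangent_space SO_C p \<and>
        (\<forall>Y\<in>tangent_space SO_C p. SO_metric p (SO_projection p A) Y = differential SO_C f p Y)"
      using SO_projection_tangent[OF p] SO_metric_projection[OF p] df by simp
  next
    fix X assume "X \<in> tangent_space SO_C p \<and>
        (\<forall>Y\<in>tangent_space SO_C p. SO_metric p X Y = differential SO_C f p Y)"
    then show "X = SO_projection p A"
      by (intro SO_metric_nondegenerate[OF p]) (simp_all add: SO_projection_tangent[OF p] SO_metric_projection[OF p] df)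
  qed
qed

lemma vector_field_gradient_linear_function:
  fixes A :: "complex^'n^'n"
  assumes f: "\<And>q. q \<in> SO_C \<Longrightarrow> f q = Re (trace (transpose A ** q))"
  shows "vector_field SO_C (gradient SO_C SO_metric f)"
  unfolding vector_field_def
proof
  have "smooth SO_C (\<lambda>q. (1/2) *\<^sub>R (A + - (q ** (transpose A ** q))))"
    by (intro smooth_bounded_linear[OF bounded_linear_scaleR_right] smooth_add smooth_const
        smooth_bounded_linear[OF bounded_linear_minus[OF bounded_linear_ident]]
        smooth_bilinear[OF bounded_bilinear_matrix_mult] smooth_linear[OF bounded_linear_ident])
  then show "smooth SO_C (gradient SO_C SO_metric f)"
    by (rule smooth_cong) (simp add: gradient_linear_function[OF f] SO_projection_def)
  show "\<forall>p\<in>SO_C. gradient SO_C SO_metric f p \<in> tangent_space SO_C p"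
    by (simp add: gradient_linear_function[OF f] SO_projection_tangent)
qed

text \<open>Two choices are resolved here: the connection by uniqueness, and the extension
  \<open>V\<close> of \<open>w\<close> because \<open>SO_connection\<close> depends on
  \<open>V\<close> at \<open>p\<close> only through \<open>V p\<close>.\<close>

lemma covariant_derivative_SO_C:
  fixes p :: "complex^'n^'n"
  assumes X: "vector_field SO_C X" and p: "p \<in> SO_C" and w: "w \<in> tangent_space SO_C p"
  shows "covariant_derivative SO_C SO_metric X p w \<in> tangent_space SO_C p"
    and "covariant_derivative SO_C SO_metric X p w =
      differential SO_C X p w + (1/2) *\<^sub>R (p ** (transpose w ** X p + transpose (X p) ** w))"
proof -
  define V where "V = (SOME V. vector_field SO_C V \<and> V p = w)"
  have V: "vector_field SO_C V" "V p = w"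
    using someI_ex[OF extend_tangent_SO_C[OF p w]] unfolding V_def by blast+
  have "levi_civita SO_C SO_metric
      (levi_civita_connection SO_C (SO_metric :: (complex^'n^'n) metric))"
    unfolding levi_civita_connection_def by (rule someI[of "levi_civita SO_C SO_metric", OF levi_civita_SO_connection])
  then have "levi_civita_connection SO_C SO_metric V X p = SO_connection V X p"
    by (rule levi_civita_unique[OF _ levi_civita_SO_connection extend_tangent_SO_C
          SO_metric_commute SO_metric_diff_left SO_metric_nondegenerate V(1) X p])
  then have *: "covariant_derivative SO_C SO_metric X p w = SO_connection V X p"
    unfolding covariant_derivative_def V_def .
  show "covariant_derivative SO_C SO_metric X p w \<in> tangent_space SO_C p"
    unfolding * by (rule SO_connection_tangent[OF V(1) X p])
  show "covariant_derivative SO_C SO_metric X p w =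
      differential SO_C X p w + (1/2) *\<^sub>R (p ** (transpose w ** X p + transpose (X p) ** w))"
    unfolding * SO_connection_def V(2) ..
qed

lemma covariant_derivative_gradient:
  fixes A p w :: "complex^'n^'n"
  assumes f: "\<And>q. q \<in> SO_C \<Longrightarrow> f q = Re (trace (transpose A ** q))"
    and p: "p \<in> SO_C" and w: "w \<in> tangent_space SO_C p"
  shows "covariant_derivative SO_C SO_metric (gradient SO_C SO_metric f) p w =
    - (1/4) *\<^sub>R (w ** (transpose A ** p + transpose p ** A) + (p ** transpose A + A ** transpose p) ** w)"
proof -
  let ?X = "gradient SO_C SO_metric f"
  have "((\<lambda>q. (1/2) *\<^sub>R (A - q ** (transpose A ** q))) has_derivative
      (\<lambda>w. (1/2) *\<^sub>R (0 - (p ** (transpose A ** w) + w ** (transpose A ** p))))) (at p within SO_C)"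
    by (intro bounded_linear.has_derivative[OF bounded_linear_scaleR_right] has_derivative_diff
        has_derivative_const bounded_bilinear.FDERIV[OF bounded_bilinear_matrix_mult]
        bounded_linear.has_derivative[OF matrix_mult.bounded_linear_right] has_derivative_ident)
  then have "(?X has_derivative
      (\<lambda>w. (1/2) *\<^sub>R (0 - (p ** (transpose A ** w) + w ** (transpose A ** p))))) (at p within SO_C)"
    by (rule has_derivative_transform[OF p, rotated])
       (simp add: gradient_linear_function[OF f] SO_projection_def)
  then have d: "differential SO_C ?X p w =
      (1/2) *\<^sub>R (0 - (p ** (transpose A ** w) + w ** (transpose A ** p)))"
    by (rule differential_eq[OF _ w])
  \<comment> \<open>Removing the transpose of \<open>w\<close> leaves a right and a left
    multiplication, whose traces factor.\<close>
  have wt: "transpose w = - (transpose p ** (w ** transpose p))"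
    using transpose_translate[OF p] w tangent_space_SO_C[OF p] by blast
  have t: "transpose w ** p = - (transpose p ** w)"
    using w tangent_space_SO_C[OF p] by blast
  have X: "?X p = (1/2) *\<^sub>R (A - p ** (transpose A ** p))"
    by (simp add: gradient_linear_function[OF f p] SO_projection_def)
  have 1: "p ** (transpose w ** ?X p) = (1/2) *\<^sub>R (w ** (transpose A ** p) - w ** (transpose p ** A))"
  proof -
    have "p ** (transpose w ** ?X p) = - (w ** (transpose p ** ?X p))"
      unfolding wt by (simp add: matrix_linear_simps matrix_mul_assoc[symmetric] SO_C_D[OF p])
    then show ?thesis unfolding X by (simp add: matrix_linear_simps SO_C_D[OF p] algebra_simps)
  qed
  have 2: "p ** (transpose (?X p) ** w) = (1/2) *\<^sub>R (p ** (transpose A ** w) - A ** (transpose p ** w))"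
    unfolding X by (simp add: matrix_linear_simps matrix_transpose_mul matrix_mul_assoc[symmetric]
        SO_C_D[OF p] algebra_simps)
  \<comment> \<open>The terms \<open>a\<close> and \<open>c\<close> get -1/2 from the flat
    derivative and 1/4 from the correction, the terms \<open>b\<close> and \<open>d\<close> only
    -1/4 from the correction; so all four end with -1/4. The identity is checked entry by
    entry.\<close>
  have sum: "(1/2) *\<^sub>R (0 - (c + a)) + (1/2) *\<^sub>R ((1/2) *\<^sub>R (a - b) + (1/2) *\<^sub>R (c - d)) =
      - (1/4) *\<^sub>R (a + b + (c + d))" for a b c d :: "complex^'n^'n"
  proof -
    have "(1/2) *\<^sub>R (0 - (z + x)) + (1/2) *\<^sub>R ((1/2) *\<^sub>R (x - y) + (1/2) *\<^sub>R (z - w)) =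
        - (1/4) *\<^sub>R (x + y + (z + w))" for x y z w :: complex
      by (simp add: scaleR_conv_of_real field_simps)
    then show ?thesis
      by (simp only: vec_eq_iff vector_scaleR_component vector_add_component
          vector_minus_component zero_index) simp
  qed
  have "covariant_derivative SO_C SO_metric ?X p w =
      differential SO_C ?X p w + (1/2) *\<^sub>R (p ** (transpose w ** ?X p + transpose (?X p) ** w))"
    by (rule covariant_derivative_SO_C(2)[OF _ p w])
       (rule vector_field_gradient_linear_function, rule f)
  also have "\<dots> = - (1/4) *\<^sub>R
      (w ** (transpose A ** p) + w ** (transpose p ** A) + (p ** (transpose A ** w) + A ** (transpose p ** w)))"
    unfolding d matrix_mult.add_right[of p] 1 2 by (rule sum)
  finally show ?thesis
    by (simp only: matrix_mult.add_right matrix_mult.add_left matrix_mul_assoc[symmetric])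
qed

lemma subspace_tangent_space_SO_C:
  fixes p :: "complex^'n^'n"
  assumes "p \<in> SO_C"
  shows "subspace (tangent_space SO_C p)"
  unfolding tangent_space_SO_C[OF assms]
  by (rule subspaceI) (simp_all add: matrix_linear_simps linear_0[OF bounded_linear.linear[OF bounded_linear_transpose]])

section \<open>Real traces over the ambient matrix space and the divergence of a gradient\<close>

lemma sum_Basis_vec:
  "(\<Sum>b\<in>(Basis :: ('a::euclidean_space^'n) set). f b) = (\<Sum>i\<in>UNIV. \<Sum>c\<in>Basis. f (axis i c))"
proof -
  have "(Basis :: ('a^'n) set) = (\<Union>i. axis i ` Basis)"
    by (auto simp: Basis_vec_def)
  moreover have "sum f (\<Union>i\<in>UNIV. axis i ` Basis) = (\<Sum>i\<in>UNIV. sum f (axis i ` Basis))"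
    by (intro sum.UNION_disjoint) (auto simp: axis_eq_axis)
  moreover have "inj_on (axis i :: 'a \<Rightarrow> 'a^'n) Basis" for i
    by (auto simp: inj_on_def axis_eq_axis)
  ultimately show ?thesis by (simp add: sum.reindex o_def)
qed

lemma sum_Basis_matrix:
  "(\<Sum>b\<in>(Basis :: (complex^'n^'m) set). f b) =
    (\<Sum>i\<in>UNIV. \<Sum>j\<in>UNIV. f (axis i (axis j 1)) + f (axis i (axis j \<i>)))"
  unfolding sum_Basis_vec by (simp add: Basis_complex_def)

text \<open>The real trace of a complex-linear map is twice the real part of its complex trace: the
  basis vectors with entry 1 and \<i> contribute equally. The complex trace of \<open>b\<close> to
  \<open>C ** (b ** D)\<close> is the product of the two traces.\<close>

lemma real_trace_mult:
  fixes C D :: "complex^'n^'n"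
  shows "(\<Sum>b\<in>Basis. (C ** (b ** D)) \<bullet> b) = 2 * Re (trace C * trace D)"
proof -
  have e: "(C ** (axis i (axis j c) ** D)) $ i $ j = C $ i $ i * (c * D $ j $ j)" for i j c
  proof -
    have "(axis i (axis j c) ** D) $ k $ l = (if k = i then c * D $ j $ l else 0)" for k l
    proof -
      have "(axis i (axis j c) ** D) $ k $ l =
          (\<Sum>m\<in>UNIV. if m = j then (if k = i then c * D $ m $ l else 0) else 0)"
        unfolding matrix_matrix_mult_def vec_lambda_beta
        by (rule sum.cong[OF refl]) (simp add: axis_def)
      then show ?thesis by simp
    qed
    then have "(C ** (axis i (axis j c) ** D)) $ i $ j =
        (\<Sum>k\<in>UNIV. if k = i then C $ i $ k * (c * D $ j $ j) else 0)"
      unfolding matrix_matrix_mult_def[of C] vec_lambda_beta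
      by (intro sum.cong[OF refl]) simp
    then show ?thesis by simp
  qed
  have "(\<Sum>b\<in>Basis. (C ** (b ** D)) \<bullet> b) = (\<Sum>i\<in>UNIV. \<Sum>j\<in>UNIV. 2 * Re (C $ i $ i * D $ j $ j))"
    unfolding sum_Basis_matrix by (intro sum.cong refl) (simp add: inner_axis e inner_complex_def)
  also have "\<dots> = 2 * Re (trace C * trace D)"
  proof -
    have "trace C * trace D = (\<Sum>i\<in>UNIV. \<Sum>j\<in>UNIV. C $ i $ i * D $ j $ j)"
      by (simp add: trace_def sum_product)
    then show ?thesis by (simp only: Re_sum sum_distrib_left)
  qed
  finally show ?thesis .
qed

lemma real_trace_mult_transpose:
  fixes C D :: "complex^'n^'n"
  shows "(\<Sum>b\<in>Basis. (C ** (transpose b ** D)) \<bullet> b) = 2 * Re (trace (transpose C ** D))"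
proof -
  have e: "(C ** (transpose (axis i (axis j c)) ** D)) $ i $ j = C $ i $ j * (c * D $ i $ j)" for i j c
  proof -
    have "(transpose (axis i (axis j c)) ** D) $ k $ l = (if k = j then c * D $ i $ l else 0)" for k l
    proof -
      have "(transpose (axis i (axis j c)) ** D) $ k $ l =
          (\<Sum>m\<in>UNIV. if m = i then (if k = j then c * D $ m $ l else 0) else 0)"
        unfolding matrix_matrix_mult_def transpose_def vec_lambda_beta
        by (rule sum.cong[OF refl]) (simp add: axis_def)
      then show ?thesis by simp
    qed
    then have "(C ** (transpose (axis i (axis j c)) ** D)) $ i $ j =
        (\<Sum>k\<in>UNIV. if k = j then C $ i $ k * (c * D $ i $ j) else 0)"
      unfolding matrix_matrix_mult_def[of C] vec_lambda_beta
      by (intro sum.cong[OF refl]) simp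
    then show ?thesis by simp
  qed
  have "(\<Sum>b\<in>Basis. (C ** (transpose b ** D)) \<bullet> b) = (\<Sum>i\<in>UNIV. \<Sum>j\<in>UNIV. 2 * Re (C $ i $ j * D $ i $ j))"
    unfolding sum_Basis_matrix by (intro sum.cong refl) (simp add: inner_axis e inner_complex_def)
  also have "\<dots> = 2 * Re (trace (transpose C ** D))"
    unfolding trace_def matrix_matrix_mult_def transpose_def
    by (subst sum.swap) (simp add: sum_distrib_left Re_sum)
  finally show ?thesis .
qed

lemma divergence_gradient_linear_function:
  fixes A p :: "complex^'n^'n"
  assumes f: "\<And>q. q \<in> SO_C \<Longrightarrow> f q = Re (trace (transpose A ** q))" and p: "p \<in> SO_C"
  shows "divergence SO_C SO_metric (gradient SO_C SO_metric f) p = - (real CARD('n) - 1) * f p"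
proof -
  define R S where "R = transpose A ** p + transpose p ** A" and "S = p ** transpose A + A ** transpose p"
  define L where "L w = - (1/4) *\<^sub>R (w ** R + S ** w)" for w
  have L: "covariant_derivative SO_C SO_metric (gradient SO_C SO_metric f) p w = L w"
    if "w \<in> tangent_space SO_C p" for w
    unfolding L_def R_def S_def by (rule covariant_derivative_gradient[OF f p that])
  have "linear L"
    by (rule linearI) (simp_all add: L_def matrix_linear_simps algebra_simps)
  have "L w \<in> tangent_space SO_C p" if "w \<in> tangent_space SO_C p" for w
    using L[OF that] covariant_derivative_SO_C(1)[OF vector_field_gradient_linear_function[OF f] p that]
    by simp
  then have "divergence SO_C SO_metric (gradient SO_C SO_metric f) p =
      (\<Sum>b\<in>Basis. L (SO_projection p b) \<bullet> b)"
    unfolding divergence_def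
    using subspace_tangent_space_SO_C[OF p] linear_SO_projection \<open>linear L\<close>
      SO_projection_tangent[OF p] SO_projection_eq[OF p] L
    by (intro trace_on_eq_sum_Basis) auto
  \<comment> \<open>Both maps are expanded: -1/8 is the -1/4 of \<open>L\<close> times the 1/2 of
    the projection. The factors \<open>mat 1\<close> bring each summand into a shape whose trace is
    known.\<close>
  also have "\<dots> = (\<Sum>b\<in>Basis. - (1/8) * ((mat 1 ** (b ** R)) \<bullet> b + (S ** (b ** mat 1)) \<bullet> b
      - (p ** (transpose b ** (p ** R))) \<bullet> b - ((S ** p) ** (transpose b ** p)) \<bullet> b))"
    by (intro sum.cong refl)
       (simp add: L_def SO_projection_def matrix_linear_simps matrix_mul_assoc[symmetric]
        inner_add_left inner_diff_left algebra_simps)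
  also have "\<dots> = - (1/8) * (2 * Re (trace (mat 1 :: complex^'n^'n) * trace R) + 2 * Re (trace S * trace (mat 1 :: complex^'n^'n))
      - 2 * Re (trace (transpose p ** (p ** R))) - 2 * Re (trace (transpose (S ** p) ** p)))"
    by (simp only: sum_distrib_left[symmetric] sum.distrib sum_subtractf real_trace_mult
        real_trace_mult_transpose)
  \<comment> \<open>The trace of \<open>mat 1\<close> is n and gives n times the traces of
    \<open>R\<close> and \<open>S\<close>; the transposed summands subtract each of these traces
    once, because \<open>p\<close> cancels against its transpose.\<close>
  also have "\<dots> = - (1/4) * (real CARD('n) - 1) * (Re (trace R) + Re (trace S))"
  proof -
    have "trace (transpose (S ** p) ** p) = trace S"
    proof -
      have "trace (transpose (S ** p) ** p) = trace (p ** (transpose p ** transpose S))"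
        by (simp add: matrix_transpose_mul trace_mul_sym[of p])
      then show ?thesis by (simp add: SO_C_D[OF p] trace_transpose)
    qed
    then show ?thesis
      by (simp add: SO_C_D[OF p] trace_I algebra_simps add_divide_distrib diff_divide_distrib)
  qed
  also have "\<dots> = - (real CARD('n) - 1) * f p"
  proof -
    have "trace (transpose p ** A) = trace (transpose A ** p)"
      by (subst trace_transpose[symmetric]) (simp add: matrix_transpose_mul)
    then have "trace R = 2 * trace (transpose A ** p)" "trace S = 2 * trace (transpose A ** p)"
      by (simp_all add: R_def S_def matrix_linear_simps trace_mul_sym[of p] trace_mul_sym[of A])
    then show ?thesis by (simp add: f[OF p] field_simps)
  qed
  finally show ?thesis .
qed

section \<open>The eigenfamily\<close>

lemma trace_outer: "trace (outer v a ** transpose z) = (\<Sum>j\<in>UNIV. \<Sum>k\<in>UNIV. v $ j * a $ k * z $ j $ k)"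
  by (simp add: trace_def matrix_matrix_mult_def outer_def transpose_def)

lemma \<phi>_fun_eq_sum:
  "z \<in> SO_C \<Longrightarrow> \<phi>_fun v a z = (\<Sum>j\<in>UNIV. \<Sum>k\<in>UNIV. v $ j * a $ k * z $ j $ k)"
  by (simp add: \<phi>_fun_def trace_outer)

lemma \<phi>_fun_eq_trace: "z \<in> SO_C \<Longrightarrow> \<phi>_fun v a z = trace (transpose (outer v a) ** z)"
  using trace_transpose[of "outer v a ** transpose z"] trace_mul_sym[of z "transpose (outer v a)"]
  by (simp add: \<phi>_fun_def matrix_transpose_mul)

lemma \<phi>_fun_add: "\<phi>_fun v (a + b) = (\<lambda>z. \<phi>_fun v a z + \<phi>_fun v b z)"
  by (auto simp: fun_eq_iff \<phi>_fun_def trace_outer algebra_simps sum.distrib)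

lemma \<phi>_fun_scale: "\<phi>_fun v (c *s a) = (\<lambda>z. c * \<phi>_fun v a z)"
  by (auto simp: fun_eq_iff \<phi>_fun_def trace_outer algebra_simps sum_distrib_left)

lemma smooth_\<phi>_fun: "smooth SO_C (\<phi>_fun v a)"
  by (rule smooth_cong[OF smooth_linear[OF bounded_linear_trace_mult]]) (simp add: \<phi>_fun_eq_trace)

lemma trace_outer_outer:
  assumes "(\<Sum>j\<in>UNIV. (v $ j)\<^sup>2) = 0"
  shows "trace (transpose (outer v a) ** outer v b) = 0"
proof -
  have "trace (transpose (outer v a) ** outer v b) =
      (\<Sum>i\<in>UNIV. \<Sum>j\<in>UNIV. a $ i * b $ i * (v $ j)\<^sup>2)"
    by (simp add: trace_def matrix_matrix_mult_def outer_def transpose_def power2_eq_square algebra_simps)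
  also have "\<dots> = 0"
    by (simp add: assms flip: sum_distrib_left)
  finally show ?thesis .
qed

text \<open>
  Since \<open>outer v a\<close> has rank one, the quadratic term of the projection factorises.
\<close>

lemma trace_outer_quadratic:
  assumes "p \<in> SO_C"
  shows "trace (transpose (outer v a) ** (p ** (transpose (outer v b) ** p))) = \<phi>_fun v a p * \<phi>_fun v b p"
proof -
  have entry: "(p ** (transpose (outer v b) ** p)) $ j $ k = (\<Sum>m\<in>UNIV. p $ j $ m * b $ m) * (\<Sum>l\<in>UNIV. v $ l * p $ l $ k)" for j k
    by (simp add: matrix_matrix_mult_def outer_def transpose_def sum_product sum_distrib_left algebra_simps)
       (rule sum.swap)
  have "trace (transpose (outer v a) ** (p ** (transpose (outer v b) ** p))) =
      (\<Sum>k\<in>UNIV. \<Sum>j\<in>UNIV. v $ j * a $ k * ((\<Sum>m\<in>UNIV. p $ j $ m * b $ m) * (\<Sum>l\<in>UNIV. v $ l * p $ l $ k)))"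
    by (simp only: trace_def matrix_matrix_mult_def[of "transpose (outer v a)"] vec_lambda_beta entry)
       (simp add: outer_def transpose_def)
  also have "\<dots> = (\<Sum>k\<in>UNIV. a $ k * (\<Sum>l\<in>UNIV. v $ l * p $ l $ k)) * (\<Sum>j\<in>UNIV. v $ j * (\<Sum>m\<in>UNIV. p $ j $ m * b $ m))"
    by (simp only: sum_product mult_ac)
  also have "(\<Sum>k\<in>UNIV. a $ k * (\<Sum>l\<in>UNIV. v $ l * p $ l $ k)) = \<phi>_fun v a p"
    unfolding \<phi>_fun_eq_sum[OF assms] by (subst sum.swap) (simp add: sum_distrib_left mult_ac)
  also have "(\<Sum>j\<in>UNIV. v $ j * (\<Sum>m\<in>UNIV. p $ j $ m * b $ m)) = \<phi>_fun v b p"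
    unfolding \<phi>_fun_eq_sum[OF assms] by (simp add: sum_distrib_left mult_ac)
  finally show ?thesis .
qed

lemma SO_metric_projection_outer:
  assumes v: "(\<Sum>j\<in>UNIV. (v $ j)\<^sup>2) = 0" and p: "p \<in> SO_C"
  shows "SO_metric p (SO_projection p (outer v a)) (SO_projection p (outer v b)) =
    - (1/2) * Re (\<phi>_fun v a p * \<phi>_fun v b p)"
  unfolding SO_metric_projection[OF p SO_projection_tangent[OF p]]
  by (simp add: SO_projection_def[of p "outer v b"] matrix_linear_simps trace_outer_outer[OF v]
      trace_outer_quadratic[OF p])

lemma Re_\<phi>_fun: "q \<in> SO_C \<Longrightarrow> Re (\<phi>_fun v a q) = Re (trace (transpose (outer v a) ** q))"
  by (simp add: \<phi>_fun_eq_trace)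

text \<open>Im z is Re (-\<i> z), and the factor is absorbed into \<open>a\<close>. Imaginary parts
  thus need no separate computation.\<close>

lemma Im_\<phi>_fun: "q \<in> SO_C \<Longrightarrow> Im (\<phi>_fun v a q) = Re (trace (transpose (outer v (- \<i> *s a)) ** q))"
  unfolding Re_\<phi>_fun[symmetric] \<phi>_fun_scale by simp

lemma gradient_\<phi>_fun:
  assumes p: "p \<in> SO_C"
  shows "gradient_C SO_C SO_metric (\<phi>_fun v a) p =
    (SO_projection p (outer v a), SO_projection p (outer v (- \<i> *s a)))"
proof -
  have "gradient SO_C SO_metric (\<lambda>q. Re (\<phi>_fun v a q)) p = SO_projection p (outer v a)"
    by (rule gradient_linear_function[OF _ p]) (rule Re_\<phi>_fun)
  moreover have "gradient SO_C SO_metric (\<lambda>q. Im (\<phi>_fun v a q)) p = SO_projection p (outer v (- \<i> *s a))"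
    by (rule gradient_linear_function[OF _ p]) (rule Im_\<phi>_fun)
  ultimately show ?thesis by (simp add: gradient_C_def)
qed

text \<open>Each real pairing carries the factor 1/2 of the projection. With x, y for the two
  values, Re (-\<i> x * (-\<i> y)) is - Re (x y), so the pairings of real and of imaginary parts add
  up to the full - Re (x y); the two mixed pairings add up to - Im (x y) likewise.\<close>

lemma conformality_\<phi>_fun:
  assumes v: "(\<Sum>j\<in>UNIV. (v $ j)\<^sup>2) = 0" and p: "p \<in> SO_C"
  shows "conformality SO_C SO_metric (\<phi>_fun v a) (\<phi>_fun v b) p = - (\<phi>_fun v a p * \<phi>_fun v b p)"
  unfolding conformality_def metric_C_def gradient_\<phi>_fun[OF p] fst_conv snd_conv
    SO_metric_projection_outer[OF assms] \<phi>_fun_scale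
  by (simp add: complex_eq_iff field_simps)

lemma tension_\<phi>_fun:
  fixes p :: "complex^'n^'n"
  assumes p: "p \<in> SO_C"
  shows "tension SO_C SO_metric (\<phi>_fun v a) p = - (of_nat CARD('n) - 1) * \<phi>_fun v a p"
proof -
  have "divergence SO_C SO_metric (gradient SO_C SO_metric (\<lambda>q. Re (\<phi>_fun v a q))) p =
      - (real CARD('n) - 1) * Re (\<phi>_fun v a p)"
    by (rule divergence_gradient_linear_function[OF _ p]) (rule Re_\<phi>_fun)
  moreover have "divergence SO_C SO_metric (gradient SO_C SO_metric (\<lambda>q. Im (\<phi>_fun v a q))) p =
      - (real CARD('n) - 1) * Im (\<phi>_fun v a p)"
    by (rule divergence_gradient_linear_function[OF _ p]) (rule Im_\<phi>_fun)
  ultimately show ?thesis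
    by (simp add: tension_def divergence_C_def gradient_C_def complex_eq_iff)
qed

section \<open>Injectivity of the parametrisation by a\<close>

definition sign_flip :: "'n \<Rightarrow> 'n \<Rightarrow> complex^'n^'n" where
  "sign_flip s t = (\<chi> l m. if l = m then if l = s \<or> l = t then -1 else 1 else 0)"

lemma sign_flip_SO_C:
  assumes "s \<noteq> t"
  shows "sign_flip s t \<in> SO_C"
proof -
  have "det (sign_flip s t) = (\<Prod>l\<in>UNIV. if l = s \<or> l = t then -1 else 1)"
    by (subst det_diagonal) (simp_all add: sign_flip_def)
  \<comment> \<open>Two distinct positions are flipped so that the determinant stays 1.\<close>
  also have "\<dots> = (\<Prod>l\<in>{s, t}. -1)"
    by (intro prod.mono_neutral_cong_right) auto
  also have "\<dots> = 1" using assms by simp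
  finally have "det (sign_flip s t) = 1" .
  moreover have "sign_flip s t ** transpose (sign_flip s t) = mat 1"
  proof -
    have "(\<Sum>m\<in>UNIV. sign_flip s t $ i $ m * sign_flip s t $ j $ m) =
        (\<Sum>m\<in>UNIV. if m = i then if i = j then 1 else 0 else 0)" for i j
      by (rule sum.cong[OF refl]) (simp add: sign_flip_def)
    then show ?thesis
      by (simp add: vec_eq_iff matrix_matrix_mult_def transpose_def mat_def)
  qed
  ultimately show ?thesis by (simp add: SO_C_def)
qed

lemma \<phi>_fun_sign_flip:
  assumes "s \<noteq> t"
  shows "\<phi>_fun v a (sign_flip s t) = (\<Sum>j\<in>UNIV. v $ j * a $ j * (if j = s \<or> j = t then -1 else 1))"
proof -
  have "(\<Sum>k\<in>UNIV. v $ j * a $ k * sign_flip s t $ j $ k) =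
      (\<Sum>k\<in>UNIV. if k = j then v $ j * a $ j * (if j = s \<or> j = t then -1 else 1) else 0)" for j
    by (rule sum.cong[OF refl]) (simp add: sign_flip_def)
  then show ?thesis
    by (simp add: \<phi>_fun_eq_sum[OF sign_flip_SO_C[OF assms]])
qed

text \<open>On the group a linear function agrees with the zero function, so both the function
  itself and 0 are derivatives of it within \<open>SO_C\<close>; they must agree on tangent
  vectors.\<close>

lemma \<phi>_fun_zero_symmetric:
  fixes p :: "complex^'n^'n"
  assumes zero: "\<And>z. z \<in> SO_C \<Longrightarrow> \<phi>_fun v a z = 0" and p: "p \<in> SO_C"
  shows "(transpose p ** outer v a) $ j $ k = (transpose p ** outer v a) $ k $ j"
proof -
  \<comment> \<open>The elementary skew matrix E_jk - E_kj; pairing with it reads off the difference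
    of the two entries in question.\<close>
  define Z :: "complex^'n^'n" where "Z = axis j (axis k 1) - axis k (axis j 1)"
  have "transpose Z = - Z"
    by (simp add: Z_def vec_eq_iff transpose_def axis_def)
  then have T: "p ** Z \<in> tangent_space SO_C p"
    by (rule tangent_curve_SO_C[OF p])
  have "((\<lambda>q. trace (transpose (outer v a) ** q)) has_derivative
      (\<lambda>q. trace (transpose (outer v a) ** q))) (at p within SO_C)"
    by (rule bounded_linear_imp_has_derivative[OF bounded_linear_trace_mult])
  moreover have "((\<lambda>q. trace (transpose (outer v a) ** q)) has_derivative (\<lambda>q. 0)) (at p within SO_C)"
    by (rule has_derivative_transform[OF p _ has_derivative_const[of 0]])
       (simp add: \<phi>_fun_eq_trace[symmetric] zero)
  ultimately have "trace (transpose (outer v a) ** (p ** Z)) = 0"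
    using has_derivative_unique_tangent T by blast
  moreover have "trace (transpose C ** axis i (axis l 1)) = C $ i $ l" for C :: "complex^'n^'n" and i l
  proof -
    have "trace (transpose C ** axis i (axis l 1)) =
        (\<Sum>m\<in>UNIV. \<Sum>n\<in>UNIV. if n = i then if m = l then C $ n $ m else 0 else 0)"
      unfolding trace_def matrix_matrix_mult_def transpose_def vec_lambda_beta
      by (intro sum.cong[OF refl]) (simp add: axis_def)
    then show ?thesis by simp
  qed
  from this[of "transpose p ** outer v a"]
  have "trace (transpose (outer v a) ** (p ** Z)) =
      (transpose p ** outer v a) $ j $ k - (transpose p ** outer v a) $ k $ j"
    by (simp add: Z_def matrix_linear_simps matrix_transpose_mul matrix_mul_assoc)
  ultimately show ?thesis by simp
qed

text \<open>
  If a function of the family vanishes, so does its derivative, which makes \<open>transpose p ** outer v a\<close> symmetric for every \<open>p\<close>.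
  Making two diagonal entries of the identity \<open>-1\<close> changes the relative sign of \<open>v $ j * a $ k\<close> and \<open>v $ k * a $ j\<close>
  because there is a third index.
\<close>

lemma \<phi>_fun_eq_0D:
  fixes v :: "complex^'n"
  assumes n: "CARD('n) \<ge> 3" and "v \<noteq> 0" and zero: "\<And>z. z \<in> SO_C \<Longrightarrow> \<phi>_fun v a z = 0"
  shows "a = 0"
proof -
  have third: "\<exists>i. i \<noteq> j \<and> i \<noteq> k" for j k :: 'n
  proof (rule ccontr)
    assume "\<nexists>i. i \<noteq> j \<and> i \<noteq> k"
    then have "UNIV \<subseteq> {j, k}" by auto
    then have "CARD('n) \<le> card {j, k}" by (intro card_mono) auto
    also have "\<dots> \<le> 2" by (simp add: card_insert_if)
    finally show False using n by simp
  qed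
  have I: "mat 1 \<in> (SO_C :: (complex^'n^'n) set)"
    by (simp add: SO_C_def)
  have sym: "v $ j * a $ k = v $ k * a $ j" for j k
    using \<phi>_fun_zero_symmetric[OF zero I, of j k] by (simp add: outer_def)
  have off: "v $ j * a $ k = 0" if "j \<noteq> k" for j k
  proof -
    obtain i where i: "i \<noteq> j" "i \<noteq> k" using third by blast
    have "(transpose (sign_flip j i) ** outer v a) $ l $ m =
        (\<Sum>n\<in>UNIV. if n = l then (if l = j \<or> l = i then -1 else 1) * (v $ l * a $ m) else 0)" for l m
      unfolding matrix_matrix_mult_def transpose_def vec_lambda_beta
      by (rule sum.cong[OF refl]) (simp add: sign_flip_def outer_def)
    then have "- (v $ j * a $ k) = v $ k * a $ j"
      using \<phi>_fun_zero_symmetric[OF zero sign_flip_SO_C, of j i j k] i that by simp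
    then have "v $ j * a $ k + v $ j * a $ k = 0"
      unfolding sym[of j k, symmetric] by (simp only: neg_eq_iff_add_eq_0)
    then show ?thesis by (simp flip: mult_2)
  qed
  have diag: "v $ j * a $ j = 0" for j
  proof -
    \<comment> \<open>Comparing the values at the identity and at \<open>sign_flip s t\<close>
      isolates the two flipped summands.\<close>
    have pair: "v $ s * a $ s + v $ t * a $ t = 0" if "s \<noteq> t" for s t
    proof -
      have "\<phi>_fun v a (mat 1) = (\<Sum>j\<in>UNIV. v $ j * a $ j)"
        unfolding \<phi>_fun_eq_sum[OF I]
        by (rule sum.cong[OF refl]) (simp add: mat_def if_distrib cong: if_cong)
      then have "0 = (\<Sum>j\<in>UNIV. v $ j * a $ j) - (\<Sum>j\<in>UNIV. v $ j * a $ j * (if j = s \<or> j = t then -1 else 1))"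
        using zero[OF I] zero[OF sign_flip_SO_C[OF that]] \<phi>_fun_sign_flip[OF that] by simp
      also have "\<dots> = (\<Sum>j\<in>UNIV. if j \<in> {s, t} then 2 * (v $ j * a $ j) else 0)"
        unfolding sum_subtractf[symmetric] by (rule sum.cong) auto
      also have "\<dots> = (\<Sum>j\<in>{s, t}. 2 * (v $ j * a $ j))"
        by (intro sum.mono_neutral_cong_right) auto
      also have "\<dots> = 2 * (v $ s * a $ s + v $ t * a $ t)"
        using that by simp
      finally show ?thesis by (simp del: distrib_left_numeral)
    qed
    obtain s where s: "s \<noteq> j" using third by blast
    obtain t where t: "t \<noteq> j" "t \<noteq> s" using third by blast
    \<comment> \<open>If x_j + x_s, x_j + x_t and x_s + x_t all vanish, then so does 2 x_j, the sum
      of the first two minus the third.\<close>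
    show ?thesis
      using pair[OF s] pair[OF t(1)] pair[OF t(2)]
      by (metis add_cancel_right_left add_left_cancel add_self_div_2 add.commute mult_2 mult_eq_0_iff zero_neq_numeral)
  qed
  obtain j where "v $ j \<noteq> 0" using \<open>v \<noteq> 0\<close> by (auto simp: vec_eq_iff)
  then have "a $ k = 0" for k
    using off[of j k] diag[of j] by (cases "k = j") auto
  then show ?thesis by (simp add: vec_eq_iff)
qed

theorem theorem11p3:
  fixes v :: "complex ^ 'n"
  assumes "CARD('n) \<ge> 3"
    and "v \<noteq> 0"
    and "(\<Sum>j\<in>UNIV. (v $ j)\<^sup>2) = 0"
  shows "cfun.subspace (E_fam v) \<and> cfun.dim (E_fam v) = CARD('n) \<and>
    eigenfamily SO_C SO_metric (E_fam v) \<and>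
    (\<forall>\<phi>\<in>E_fam v. \<forall>\<psi>\<in>E_fam v. \<forall>z\<in>SO_C.
       tension SO_C SO_metric \<phi> z = - (of_nat CARD('n) - 1) * \<phi> z \<and>
       conformality SO_C SO_metric \<phi> \<psi> z = - (\<phi> z * \<psi> z))"
proof -
  interpret finite_dimensional_vector_space_pair_1
    "(*s) :: complex \<Rightarrow> complex^'n \<Rightarrow> complex^'n" cart_basis
    "\<lambda>(c::complex) (f :: complex^'n^'n \<Rightarrow> complex) x. c * f x"
    by unfold_locales
  have lin: "Vector_Spaces.linear (*s) (\<lambda>c f x. c * f x) (\<phi>_fun v)"
    by unfold_locales (simp_all add: \<phi>_fun_add \<phi>_fun_scale fun_eq_iff)
  have inj: "inj (\<phi>_fun v)"
  proof (rule injI)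
    fix a b assume eq: "\<phi>_fun v a = \<phi>_fun v b"
    \<comment> \<open>The difference is written as a sum with a multiple, so that the additive and
      scalar laws of \<open>\<phi>_fun\<close> apply and only the kernel is to be
      determined.\<close>
    have "\<phi>_fun v (a + (-1) *s b) z = 0" for z
      unfolding \<phi>_fun_add \<phi>_fun_scale eq by simp
    then have "a + (-1) *s b = 0"
      using \<phi>_fun_eq_0D[OF assms(1,2)] by blast
    then show "a = b" by simp
  qed
  have "cfun.subspace (E_fam v)"
    unfolding E_fam_def using lin vec.subspace_UNIV linear_subspace_image by blast
  moreover have "cfun.dim (E_fam v) = CARD('n)"
    unfolding E_fam_def using dim_image_eq[OF lin, of UNIV] inj vec_dim_card by simp
  moreover have eq: "\<forall>\<phi>\<in>E_fam v. \<forall>\<psi>\<in>E_fam v. \<forall>z\<in>SO_C.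
       tension SO_C SO_metric \<phi> z = - (of_nat CARD('n) - 1) * \<phi> z \<and>
       conformality SO_C SO_metric \<phi> \<psi> z = - (\<phi> z * \<psi> z)"
    using tension_\<phi>_fun conformality_\<phi>_fun[OF assms(3)] by (auto simp: E_fam_def)
  moreover have "eigenfamily SO_C SO_metric (E_fam v)"
    unfolding eigenfamily_def
  proof (intro conjI exI)
    show "\<forall>\<phi>\<in>E_fam v. smooth SO_C \<phi>"
      by (auto simp: E_fam_def smooth_\<phi>_fun)
    show "\<forall>\<phi>\<in>E_fam v. \<forall>\<psi>\<in>E_fam v. \<forall>p\<in>SO_C.
        tension SO_C SO_metric \<phi> p = - (of_nat CARD('n) - 1) * \<phi> p \<and>
        conformality SO_C SO_metric \<phi> \<psi> p = -1 * \<phi> p * \<psi> p"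
      using eq by simp
  qed
  ultimately show ?thesis by blast
qed

end
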